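(* Let $n\ge1$, and let $\alpha_3,\alpha_5,\dots,\alpha_{2n+1}$ with $\alpha_{2k+1}\in\pi_{2k+1}(SU(k+1))$ be the elements defined inductively by iterated commutators with contractions of the circles $\lambda_k$ (construction in the context). Then $\alpha_{2k+1}\in\pi_{2k+1}(SU(k+1))$ is nonzero for $k=1,\dots,n$.
   Context: Embed $SU(k)\subset SU(k+1)$ as the subgroup acting on the first $k$ coordinates. For $k\ge1$ let $\lambda_k:S^1\to SU(k+1)$ be the diagonal circle subgroup with weights $(1,\dots,1,-k)$, i.e. $\lambda_k(t)=\mathrm{diag}(t,\dots,t,t^{-k})$ with $k$ entries $t$. It commutes with $SU(k)$ and, since $SU(k+1)$ is simply connected, it extends to a map $\widetilde\lambda_k:D^2\to SU(k+1)$ (unique up to homotopy rel boundary because $\pi_2(SU(k+1))=0$). Write $\langle x,y\rangle=xyx^{-1}y^{-1}$. Put $\alpha_1:=\lambda_1:S^1\to SU(2)$. Inductively, given a based map $\alpha_{2k-1}:S^{2k-1}\to SU(k)$ (for $k=1$, $\alpha_1=\lambda_1$), the map $D^2\times S^{2k-1}\to SU(k+1)$, $(x,t)\mapsto\langle\widetilde\lambda_k(x),\alpha_{2k-1}(t)\rangle$, is the identity on $(\partial D^2\times S^{2k-1})\cup(D^2\times\{*\})$, so descends to a map on $S^{2k+1}=(D^2\times S^{2k-1})/\bigl((\partial D^2\times S^{2k-1})\cup(D^2\times\{*\})\bigr)$. Its homotopy class is $\alpha_{2k+1}\in\pi_{2k+1}(SU(k+1))$. *)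

theory Defs
  imports
    "Jordan_Normal_Form.Determinant"
    "Jordan_Normal_Form.Schur_Decomposition"
    "HOL-Analysis.Abstract_Euclidean_Space"
begin

section \<open>The special unitary groups\<close>

definition SU :: "nat \<Rightarrow> complex mat monoid" where
  "SU n = \<lparr>carrier = {A \<in> carrier_mat n n. A * mat_adjoint A = 1\<^sub>m n \<and> Determinant.det A = 1},
           monoid.mult = (*), one = 1\<^sub>m n\<rparr>"

lemma mat_adjoint_carrier: "A \<in> carrier_mat n n \<Longrightarrow> mat_adjoint A \<in> carrier_mat n n"
  by (auto simp: mat_adjoint_def)

lemma index_mat_adjoint:
  assumes "A \<in> carrier_mat n n" "i < n" "j < n"
  shows "mat_adjoint A $$ (i, j) = cnj (A $$ (j, i))"
  using assms by (auto simp: mat_adjoint_def mat_of_rows_def conjugate_vec_def)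

lemma mat_adjoint_mult:
  assumes A: "A \<in> carrier_mat n n" and B: "(B :: complex mat) \<in> carrier_mat n n"
  shows "mat_adjoint (A * B) = mat_adjoint B * mat_adjoint A"
proof (rule eq_matI)
  note c = mat_adjoint_carrier[OF A] mat_adjoint_carrier[OF B] mult_carrier_mat[OF A B]
  have c': "mat_adjoint B * mat_adjoint A \<in> carrier_mat n n"
    "mat_adjoint (A * B) \<in> carrier_mat n n"
    using c mat_adjoint_carrier by auto
  show "dim_row (mat_adjoint (A * B)) = dim_row (mat_adjoint B * mat_adjoint A)"
    "dim_col (mat_adjoint (A * B)) = dim_col (mat_adjoint B * mat_adjoint A)"
    using c' by auto
  fix i j
  assume "i < dim_row (mat_adjoint B * mat_adjoint A)" "j < dim_col (mat_adjoint B * mat_adjoint A)"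
  then have ij: "i < n" "j < n" using c' by auto
  have "mat_adjoint (A * B) $$ (i, j) = cnj (\<Sum>k<n. A $$ (j, k) * B $$ (k, i))"
    using ij A B by (simp add: index_mat_adjoint[OF c(3)] scalar_prod_def lessThan_atLeast0)
  also have "\<dots> = (\<Sum>k<n. mat_adjoint B $$ (i, k) * mat_adjoint A $$ (k, j))"
    using ij by (simp add: index_mat_adjoint[OF A] index_mat_adjoint[OF B] mult.commute)
  also have "\<dots> = (mat_adjoint B * mat_adjoint A) $$ (i, j)"
    using ij c by (simp add: scalar_prod_def lessThan_atLeast0)
  finally show "mat_adjoint (A * B) $$ (i, j) = (mat_adjoint B * mat_adjoint A) $$ (i, j)" .
qed

lemma mat_adjoint_adjoint:
  assumes A: "(A :: complex mat) \<in> carrier_mat n n"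
  shows "mat_adjoint (mat_adjoint A) = A"
  using assms mat_adjoint_carrier[OF A] mat_adjoint_carrier[OF mat_adjoint_carrier[OF A]]
  by (intro eq_matI)
    (auto simp: index_mat_adjoint[OF A] index_mat_adjoint[OF mat_adjoint_carrier[OF A]])

lemma mat_adjoint_one: "mat_adjoint (1\<^sub>m n :: complex mat) = 1\<^sub>m n"
  using mat_adjoint_carrier[of "1\<^sub>m n :: complex mat" n]
  by (intro eq_matI) (auto simp: index_mat_adjoint[of _ n])

lemma mat_adjoint_diag: "mat_adjoint (mat_diag n f) = mat_diag n (\<lambda>i. cnj (f i))"
proof (rule eq_matI)
  fix i j
  assume "i < dim_row (mat_diag n (\<lambda>i. cnj (f i)))" "j < dim_col (mat_diag n (\<lambda>i. cnj (f i)))"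
  then have ij: "i < n" "j < n" by (auto simp: mat_diag_def)
  show "mat_adjoint (mat_diag n f) $$ (i, j) = mat_diag n (\<lambda>i. cnj (f i)) $$ (i, j)"
    unfolding index_mat_adjoint[OF mat_diag_dim ij] using ij by (auto simp: mat_diag_def)
qed (use mat_adjoint_carrier[OF mat_diag_dim, of n f] in \<open>auto simp: mat_diag_def\<close>)

lemma group_SU: "group (SU n)"
proof (rule groupI)
  fix x y
  assume "x \<in> carrier (SU n)" "y \<in> carrier (SU n)"
  then have x: "x \<in> carrier_mat n n" "x * mat_adjoint x = 1\<^sub>m n" "Determinant.det x = 1"
    and y: "y \<in> carrier_mat n n" "y * mat_adjoint y = 1\<^sub>m n" "Determinant.det y = 1"
    by (auto simp: SU_def)
  note a = mat_adjoint_carrier[OF x(1)] mat_adjoint_carrier[OF y(1)]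
  have "(x * y) * mat_adjoint (x * y) = x * ((y * mat_adjoint y) * mat_adjoint x)"
    using x(1) y(1) a by (simp add: mat_adjoint_mult[OF x(1) y(1)] assoc_mult_mat[of _ n n _ n _ n])
  also have "\<dots> = 1\<^sub>m n"
    using x y a by simp
  finally show "x \<otimes>\<^bsub>SU n\<^esub> y \<in> carrier (SU n)"
    using x y by (simp add: SU_def det_mult[OF x(1) y(1)])
next
  show "\<one>\<^bsub>SU n\<^esub> \<in> carrier (SU n)"
    by (simp add: SU_def mat_adjoint_one)
next
  fix x y z
  assume "x \<in> carrier (SU n)" "y \<in> carrier (SU n)" "z \<in> carrier (SU n)"
  then show "x \<otimes>\<^bsub>SU n\<^esub> y \<otimes>\<^bsub>SU n\<^esub> z = x \<otimes>\<^bsub>SU n\<^esub> (y \<otimes>\<^bsub>SU n\<^esub> z)"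
    by (auto simp: SU_def)
next
  fix x
  assume "x \<in> carrier (SU n)"
  then show "\<one>\<^bsub>SU n\<^esub> \<otimes>\<^bsub>SU n\<^esub> x = x"
    by (auto simp: SU_def)
next
  fix x
  assume "x \<in> carrier (SU n)"
  then have x: "x \<in> carrier_mat n n" "x * mat_adjoint x = 1\<^sub>m n" "Determinant.det x = 1"
    by (auto simp: SU_def)
  note a = mat_adjoint_carrier[OF x(1)]
  have l: "mat_adjoint x * x = 1\<^sub>m n"
    by (rule mat_mult_left_right_inverse[OF x(1) a x(2)])
  have "Determinant.det (x * mat_adjoint x) = 1"
    unfolding x(2) by simp
  then have "Determinant.det (mat_adjoint x) = 1"
    using det_mult[OF x(1) a] x(3) by simp
  then have "mat_adjoint x \<in> carrier (SU n)"
    using l a by (simp add: SU_def mat_adjoint_adjoint[OF x(1)])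
  then show "\<exists>y\<in>carrier (SU n). y \<otimes>\<^bsub>SU n\<^esub> x = \<one>\<^bsub>SU n\<^esub>"
    using l by (intro bexI[of _ "mat_adjoint x"]) (simp_all add: SU_def)
qed

text \<open>The topology of entrywise convergence; the restriction to \<open>{..<n} \<times> {..<n}\<close> is needed because
  a matrix has unspecified entries outside this range.\<close>

definition SU_space :: "nat \<Rightarrow> complex mat topology" where
  "SU_space n =
     pullback_topology (carrier (SU n)) (\<lambda>A. restrict (\<lambda>p. A $$ p) ({..<n} \<times> {..<n}))
       (product_topology (\<lambda>_. euclidean) ({..<n} \<times> {..<n}))"

lemma topspace_SU_space: "topspace (SU_space n) = carrier (SU n)"
  by (auto simp: SU_space_def topspace_pullback_topology)

text \<open>The embedding of \<open>SU(k)\<close> into \<open>SU(k + 1)\<close> as the subgroup acting on the first \<open>k\<close> coordinates.\<close>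

definition SU_embed :: "complex mat \<Rightarrow> complex mat" where
  "SU_embed A = four_block_mat A (0\<^sub>m (dim_row A) 1) (0\<^sub>m 1 (dim_col A)) (1\<^sub>m 1)"

definition group_commutator :: "('a, 'b) monoid_scheme \<Rightarrow> 'a \<Rightarrow> 'a \<Rightarrow> 'a" where
  "group_commutator G x y = x \<otimes>\<^bsub>G\<^esub> y \<otimes>\<^bsub>G\<^esub> inv\<^bsub>G\<^esub> x \<otimes>\<^bsub>G\<^esub> inv\<^bsub>G\<^esub> y"

section \<open>Homotopy groups\<close>

definition sphere_base :: "nat \<Rightarrow> real" where
  "sphere_base = (\<lambda>i. if i = 0 then 1 else 0)"

definition based_maps :: "nat \<Rightarrow> 'a topology \<Rightarrow> 'a \<Rightarrow> ((nat \<Rightarrow> real) \<Rightarrow> 'a) set" where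
  "based_maps m X x0 = {f. continuous_map (nsphere m) X f \<and> f sphere_base = x0}"

definition based_homotopy_class ::
    "nat \<Rightarrow> 'a topology \<Rightarrow> 'a \<Rightarrow> ((nat \<Rightarrow> real) \<Rightarrow> 'a) \<Rightarrow> ((nat \<Rightarrow> real) \<Rightarrow> 'a) set" where
  "based_homotopy_class m X x0 f =
     {g. homotopic_with (\<lambda>h. h sphere_base = x0) (nsphere m) X f g}"

text \<open>The elements of \<open>\<pi>\<^sub>m(X, x0)\<close> for \<open>m \<ge> 1\<close>, and its neutral element.\<close>

definition homotopy_group_set :: "nat \<Rightarrow> 'a topology \<Rightarrow> 'a \<Rightarrow> ((nat \<Rightarrow> real) \<Rightarrow> 'a) set set" where
  "homotopy_group_set m X x0 = based_homotopy_class m X x0 ` based_maps m X x0"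

definition homotopy_group_zero :: "nat \<Rightarrow> 'a topology \<Rightarrow> 'a \<Rightarrow> ((nat \<Rightarrow> real) \<Rightarrow> 'a) set" where
  "homotopy_group_zero m X x0 = based_homotopy_class m X x0 (\<lambda>_. x0)"

section \<open>Commutators with contractions of circles\<close>

definition lambda_circle :: "nat \<Rightarrow> complex \<Rightarrow> complex mat" where
  "lambda_circle k z = mat_diag (k + 1) (\<lambda>i. if i < k then z else z powi (- int k))"

lemma lambda_circle_in_SU:
  assumes "z \<in> sphere 0 1"
  shows "lambda_circle k z \<in> carrier (SU (k + 1))"
proof -
  have z: "norm z = 1" "z \<noteq> 0" using assms by auto
  have c: "lambda_circle k z \<in> carrier_mat (k + 1) (k + 1)"
    by (simp add: lambda_circle_def)
  have zz: "w * cnj w = 1" if "norm w = 1" for w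
    using that by (simp add: complex_norm_square[symmetric])
  have nw: "norm (z powi (- int k)) = 1"
    using z by (simp only: norm_power_int) simp
  have adj: "mat_adjoint (lambda_circle k z) =
      mat_diag (k + 1) (\<lambda>i. cnj (if i < k then z else z powi (- int k)))"
    unfolding lambda_circle_def by (rule mat_adjoint_diag)
  have "(\<lambda>i. (if i < k then z else z powi (- int k)) * cnj (if i < k then z else z powi (- int k)))
      = (\<lambda>i. 1)"
    using zz[OF z(1)] zz[OF nw] by auto
  then have "lambda_circle k z * mat_adjoint (lambda_circle k z) = 1\<^sub>m (k + 1)"
    unfolding adj by (simp add: lambda_circle_def)
  moreover have "Determinant.det (lambda_circle k z) = prod_list (diag_mat (lambda_circle k z))"
    by (rule det_upper_triangular[OF _ c])
      (auto simp: upper_triangular_def lambda_circle_def mat_diag_def)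
  moreover have "diag_mat (lambda_circle k z) = map (\<lambda>_. z) [0..<k] @ [z powi (- int k)]"
    by (auto simp: diag_mat_def lambda_circle_def mat_diag_def)
  moreover have "prod_list (map (\<lambda>_. z) [0..<k] @ [z powi (- int k)]) = 1"
    using z by (simp add: map_replicate_const prod_list_replicate power_int_minus)
  ultimately show ?thesis
    using c by (simp add: SU_def)
qed

definition circle_contraction :: "nat \<Rightarrow> (complex \<Rightarrow> complex mat) \<Rightarrow> bool" where
  "circle_contraction k g \<longleftrightarrow>
     continuous_map (top_of_set (cball 0 1)) (SU_space (k + 1)) g \<and>
     (\<forall>x\<in>sphere 0 1. g x = lambda_circle k x)"

definition collapsed_set :: "nat \<Rightarrow> (complex \<times> (nat \<Rightarrow> real)) set" where
  "collapsed_set m = sphere 0 1 \<times> topspace (nsphere m) \<union> cball 0 1 \<times> {sphere_base}"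

text \<open>\<open>q\<close> exhibits \<open>S\<^bsup>m+2\<^esup>\<close> as the quotient \<open>(D\<^sup>2 \<times> S\<^bsup>m\<^esup>) / collapsed_set m\<close>, with the class of
  the collapsed set as base point.\<close>

definition sphere_identification ::
    "nat \<Rightarrow> (complex \<times> (nat \<Rightarrow> real) \<Rightarrow> (nat \<Rightarrow> real)) \<Rightarrow> bool" where
  "sphere_identification m q \<longleftrightarrow>
     quotient_map (prod_topology (top_of_set (cball 0 1)) (nsphere m)) (nsphere (m + 2)) q \<and>
     (\<forall>u\<in>collapsed_set m. q u = sphere_base) \<and>
     (\<forall>u\<in>cball 0 1 \<times> topspace (nsphere m). \<forall>v\<in>cball 0 1 \<times> topspace (nsphere m).
        q u = q v \<longrightarrow> u = v \<or> (u \<in> collapsed_set m \<and> v \<in> collapsed_set m))"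

text \<open>\<open>c\<close> is the homotopy class of the map \<open>f\<close> on \<open>S\<^bsup>2k+1\<^esup>\<close> to which the map
  \<open>(x, t) \<mapsto> \<langle>g x, a t\<rangle>\<close> descends, for some contraction \<open>g\<close> of \<open>\<lambda>\<^sub>k\<close>. Here \<open>a\<close> takes values in
  \<open>SU(k + 1)\<close>, i.e. it is already composed with the embedding of \<open>SU(k)\<close> when \<open>k \<ge> 2\<close>.\<close>

definition commutator_class ::
    "nat \<Rightarrow> ((nat \<Rightarrow> real) \<Rightarrow> complex mat) \<Rightarrow> ((nat \<Rightarrow> real) \<Rightarrow> complex mat) set \<Rightarrow> bool" where
  "commutator_class k a c \<longleftrightarrow>
     (\<exists>g q f. circle_contraction k g \<and> sphere_identification (2 * k - 1) q \<and>
        (\<forall>x\<in>cball 0 1. \<forall>t\<in>topspace (nsphere (2 * k - 1)).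
           f (q (x, t)) = group_commutator (SU (k + 1)) (g x) (a t)) \<and>
        c = based_homotopy_class (2 * k + 1) (SU_space (k + 1)) \<one>\<^bsub>SU (k + 1)\<^esub> f)"

text \<open>\<open>\<lambda>\<^sub>1\<close> on the circle \<open>nsphere 1\<close>. This is a map into \<open>SU(2)\<close> (not \<open>SU(1)\<close>), and it has to be
  this very map rather than its homotopy class, which is trivial in \<open>SU(2)\<close>.\<close>

definition alpha_1 :: "(nat \<Rightarrow> real) \<Rightarrow> complex mat" where
  "alpha_1 t = lambda_circle 1 (Complex (t 0) (t 1))"

end

theory Submission
  imports
    Defs
    "HOL-Homology.Brouwer_Degree"
    "HOL-Analysis.Abstract_Topological_Spaces"
    "HOL-Analysis.Further_Topology"
begin

text \<open>The invariant is the degree of the map \<open>S\<^bsup>2k+1\<^esup> \<rightarrow> SU(k+1) \<rightarrow> S\<^bsup>2k+1\<^esup>\<close> given by the last column of a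
  representative of \<open>\<alpha>\<^bsub>2k+1\<^esub>\<close>. Let \<open>a\<close> represent \<open>\<alpha>\<^bsub>2k-1\<^esub>\<close>, with last column \<open>\<phi>\<close>, and let \<open>v z\<close> be the last
  column of \<open>(g z)\<^sup>-\<^sup>1\<close>. Since \<open>a u\<close> fixes the last basis vector, the last column of \<open>\<langle>g z, a u\<rangle>\<close> is
  \<open>g z (a u (v z))\<close>, and for \<open>z\<close> on the circle it does not depend on \<open>u\<close>; so it is a map on the join
  \<open>S\<^bsup>2k+1\<^esup>\<close> of \<open>S\<^bsup>2k-1\<^esup>\<close> with the circle. There the factor \<open>g z\<close> can be contracted away, and \<open>v\<close> can be deformed,
  relative to its boundary values \<open>z\<^sup>k\<close> in the last coordinate, to the standard disc in the last two
  coordinates. What remains is the join of \<open>\<phi>\<close> with the \<open>k\<close>-th power map of the circle, of degree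
  \<open>k deg \<phi>\<close>. The induction starts with \<open>k = 1\<close>, where \<open>\<alpha>\<^sub>1\<close> does not fix the last basis vector but
  multiplies it by \<open>u\<^sup>-\<^sup>1\<close>; this replaces \<open>\<phi>\<close> by \<open>u\<^sup>2\<close>, of degree \<open>2\<close>.\<close>

section \<open>Suspension and addition of degrees\<close>

text \<open>The commutator condition determines \<open>f\<close> only through an arbitrary
  identification \<open>q\<close>. The coordinates \<open>join_map\<close> collapse less than
  \<open>q\<close>, so \<open>q\<close> is \<open>p\<close> after \<open>join_map\<close> for some
  self-map \<open>p\<close> of the sphere. What is computed is the degree of
  \<open>last_column\<close> after \<open>f\<close> after \<open>p\<close>; it is a product of
  degrees and it is nonzero, so the factor belonging to \<open>f\<close> is nonzero whatever
  \<open>p\<close> is. The cases k = 1 and k \<ge> 2 are one computation. If \<open>a\<close> is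
  block diagonal with lower corner \<mu>, the inverse of \<open>a\<close> acts on the last basis
  vector by \<open>cnj \<mu>\<close>; absorbing this scalar into \<open>a\<close> leaves a block
  matrix with corner 1. The spheres have variable dimension and functions as points, whereas
  extension of maps is used in a fixed Euclidean type. Hence \<open>v\<close> is first pushed into
  its last two complex coordinates. The unit sphere of C^2 has dimension 3, just that of [0,1] x
  D^2, so a homotopy of discs prescribed on the boundary of this cylinder extends over it; and there
  are two last coordinates for every k \<ge> 1.\<close>

text \<open>Keeping the last coordinate means preserving both hemispheres and the equator. So
  \<open>F\<close> is compatible with the isomorphisms H_n(S^n) <- H_{n+1}(D+, S^n) ->
  H_{n+1}(S^{n+1}, D-) <- H_{n+1}(S^{n+1}), and multiplication by the degree on the equator is
  carried along them.\<close>

lemma Brouwer_degree2_suspension: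
  fixes F :: "(nat \<Rightarrow> real) \<Rightarrow> nat \<Rightarrow> real"
  assumes F: "continuous_map (nsphere (Suc n)) (nsphere (Suc n)) F"
    and last: "\<And>x. x \<in> topspace (nsphere (Suc n)) \<Longrightarrow> F x (Suc n) = x (Suc n)"
  shows "continuous_map (nsphere n) (nsphere n) F"
    and "Brouwer_degree2 (Suc n) F = Brouwer_degree2 n F"
proof -
  \<comment> \<open>Agrees with \<open>F\<close> on the sphere, but keeps the last coordinate at
    every point, so that the half spaces are mapped into themselves outside the sphere too.\<close>
  define r where "r x = (\<lambda>i. if i = Suc n then x i else F x i)" for x
  have rF: "r x = F x" if "x \<in> topspace (nsphere (Suc n))" for x
    using last[OF that] by (auto simp: r_def)
  have sub: "topspace (nsphere n) \<subseteq> topspace (nsphere (Suc n))"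
    by (metis subtopology_nsphere_equator topspace_subtopology inf_le1)
  have cmr: "continuous_map (nsphere (Suc n)) (nsphere (Suc n)) r"
    using F continuous_map_eq rF by metis
  have rsub: "r \<in> {x. 0 \<le> x (Suc n)} \<rightarrow> {x. 0 \<le> x (Suc n)}"
             "r \<in> {x. x (Suc n) \<le> 0} \<rightarrow> {x. x (Suc n) \<le> 0}"
             "r \<in> {x. x (Suc n) = 0} \<rightarrow> {x. x (Suc n) = 0}"
    by (force simp: r_def)+
  have cmr': "continuous_map (nsphere n) (nsphere n) r"
  proof -
    have "continuous_map (subtopology (nsphere (Suc n)) {x. x (Suc n) = 0})
        (subtopology (nsphere (Suc n)) {x. x (Suc n) = 0}) r"
      using continuous_map_from_subtopology[OF cmr] rsub(3)
      by (intro continuous_map_into_subtopology) auto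
    then show ?thesis
      by (simp only: subtopology_nsphere_equator)
  qed
  then show contF: "continuous_map (nsphere n) (nsphere n) F"
    using continuous_map_eq rF sub by (metis subset_iff)
  let ?sub = "subtopology (nsphere (Suc n)) {x. x (Suc n) \<ge> 0}"
  let ?E = "{x. x (Suc n) = (0::real)}"
  let ?L = "{x. x (Suc n) \<le> (0::real)}"
  let ?p = "int n"
  let ?d = "Brouwer_degree2 n F"
  let ?R = "reduced_homology_group ?p (nsphere n)"
  let ?S = "reduced_homology_group (1 + ?p) (nsphere (Suc n))"
  let ?G = "relative_homology_group (1 + ?p) ?sub ?E"
  let ?H = "relative_homology_group (1 + ?p) (nsphere (Suc n)) ?L"
  let ?rG = "hom_induced (1 + ?p) ?sub ?E ?sub ?E r"
  let ?rH = "hom_induced (1 + ?p) (nsphere (Suc n)) ?L (nsphere (Suc n)) ?L r"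
  let ?rS = "hom_induced (1 + ?p) (nsphere (Suc n)) {} (nsphere (Suc n)) {} r"
  let ?f = "hom_boundary (1 + ?p) ?sub ?E"
  let ?i = "hom_induced (1 + ?p) ?sub ?E (nsphere (Suc n)) ?L id"
  let ?h = "hom_induced (1 + ?p) (nsphere (Suc n)) {} (nsphere (Suc n)) ?L id"
  have f: "?f \<in> iso ?G ?R"
    by (rule iso_upper_hemisphere_reduced_homology_group)
  have i: "?i \<in> iso ?G ?H"
    by (rule iso_relative_homology_group_upper_hemisphere)
  have h: "?h \<in> iso ?S ?H"
    by (rule iso_reduced_homology_group_lower_hemisphere) simp
  interpret f: group_hom ?G ?R ?f
    using f unfolding group_hom_def group_hom_axioms_def iso_def by simp
  interpret i: group_hom ?G ?H ?i
    using i unfolding group_hom_def group_hom_axioms_def iso_def by simp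
  interpret h: group_hom ?S ?H ?h
    using h unfolding group_hom_def group_hom_axioms_def iso_def by simp
  have injf: "inj_on ?f (carrier ?G)" and surji: "?i ` carrier ?G = carrier ?H"
    and injh: "inj_on ?h (carrier ?S)"
    using f i h by (simp_all add: iso_def bij_betw_def)
  have cmrs: "continuous_map ?sub ?sub r"
    using continuous_map_from_subtopology[OF cmr] rsub(1)
    by (intro continuous_map_into_subtopology) auto
  have rG: "?rG c = c [^]\<^bsub>?G\<^esub> ?d" if c: "c \<in> carrier ?G" for c
  proof -
    have "hom_induced ?p (nsphere n) {} (nsphere n) {} r \<circ> ?f = ?f \<circ> ?rG"
      using naturality_hom_induced [OF cmrs rsub(3), symmetric, of "1 + ?p", simplified]
      by (simp add: Pi_iff subtopology_subtopology subtopology_nsphere_equator flip: Collect_conj_eq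
          cong: rev_conj_cong)
    then have "?f (?rG c) = hom_induced ?p (nsphere n) {} (nsphere n) {} r (?f c)"
      by (metis comp_apply)
    also have "\<dots> = hom_induced ?p (nsphere n) {} (nsphere n) {} F (?f c)"
      by (rule fun_cong[OF hom_induced_eq]) (use rF sub in blast)
    also have "\<dots> = (?f c) [^]\<^bsub>?R\<^esub> ?d"
      using f.hom_closed[OF c] by (rule Brouwer_degree2)
    also have "\<dots> = ?f (c [^]\<^bsub>?G\<^esub> ?d)"
      using f.hom_int_pow[OF c] by simp
    finally show ?thesis
      by (rule inj_onD[OF injf _ hom_induced_carrier f.G.int_pow_closed[OF c]])
  qed
  have rH: "?rH c = c [^]\<^bsub>?H\<^esub> ?d" if c: "c \<in> carrier ?H" for c
  proof -
    obtain b where b: "b \<in> carrier ?G" "c = ?i b"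
      using surji c by blast
    have "?rH (?i b) = ?i (?rG b)"
      apply (simp add: rsub hom_induced_compose' Collect_mono_iff cmr)
      apply (subst hom_induced_compose')
          apply (simp_all add: continuous_map_in_subtopology continuous_map_from_subtopology [OF cmr] rsub)
       apply (auto simp: r_def)
      done
    then show ?thesis
      using b rG[OF b(1)] i.hom_int_pow[OF b(1)] by simp
  qed
  have rS: "?rS c = c [^]\<^bsub>?S\<^esub> ?d" if c: "c \<in> carrier ?S" for c
  proof -
    have "?h (?rS c) = ?rH (?h c)"
      by (simp add: hom_induced_compose' cmr rsub)
    also have "\<dots> = ?h (c [^]\<^bsub>?S\<^esub> ?d)"
      using rH h.hom_closed[OF c] h.hom_int_pow[OF c] by simp
    finally show ?thesis
      by (rule inj_onD[OF injh _ hom_induced_reduced[OF c] h.G.int_pow_closed[OF c]])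
  qed
  have "Brouwer_degree2 (Suc n) r = ?d"
    by (rule Brouwer_degree2_unique[OF cmr]) (use rS in \<open>simp add: algebra_simps\<close>)
  then show "Brouwer_degree2 (Suc n) F = ?d"
    using Brouwer_degree2_eq[of "Suc n" r F, OF rF] by simp
qed

text \<open>Here the hypotheses hold at all points, not only on the sphere, because \<open>hom_induced_compose\<close> needs
  \<open>f \<in> S \<rightarrow> T\<close> on all of \<open>S\<close>.\<close>

lemma Brouwer_degree2_pinch_aux:
  fixes f g :: "(nat \<Rightarrow> real) \<Rightarrow> nat \<Rightarrow> real"
  assumes "n > 0" and f: "continuous_map (nsphere n) (nsphere n) f"
    and g: "continuous_map (nsphere n) (nsphere n) g"
    and h: "continuous_map (nsphere n) (nsphere n) h"
    and hf: "\<And>x. x n \<ge> 0 \<Longrightarrow> h x = f x" and hg: "\<And>x. x n \<le> 0 \<Longrightarrow> h x = g x"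
    and fb: "\<And>x. x n \<le> 0 \<Longrightarrow> f x = b" and gb: "\<And>x. x n \<ge> 0 \<Longrightarrow> g x = b"
  shows "Brouwer_degree2 n h = Brouwer_degree2 n f + Brouwer_degree2 n g"
proof (rule Brouwer_degree2_unique[OF h])
  let ?S = "nsphere n"
  let ?E = "{x. x n = (0::real)}"
  let ?U = "subtopology (nsphere n) {x. x n \<ge> 0}"
  let ?L = "subtopology (nsphere n) {x. x n \<le> 0}"
  let ?G = "relative_homology_group n ?S ?E"
  let ?K = "relative_homology_group n ?S {b}"
  let ?R = "reduced_homology_group n ?S"
  let ?iU = "hom_induced n ?U ?E ?S ?E id"
  let ?iL = "hom_induced n ?L ?E ?S ?E id"
  let ?k = "\<lambda>f. hom_induced n ?S ?E ?S {b} f"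
  let ?j = "hom_induced n ?S {} ?S {b} id"
  let ?e = "hom_induced n ?S {} ?S ?E id"
  have b: "b \<in> topspace ?S"
  proof -
    have "f (\<lambda>i. if i = 0 then 1 else 0) = b"
      using \<open>n > 0\<close> by (intro fb) simp
    then show ?thesis
      using continuous_map_image_subset_topspace[OF f] in_topspace_nsphere[of n] by blast
  qed
  have topb: "topspace (subtopology ?S {b}) = {b}"
    using b by simp
  have mapsE: "f \<in> ?E \<rightarrow> {b}" "g \<in> ?E \<rightarrow> {b}" "h \<in> ?E \<rightarrow> {b}"
    by (simp_all add: fb gb hf)
  interpret G: comm_group ?G by simp
  interpret K: comm_group ?K by simp
  have khom: "?k u \<in> hom ?G ?K" for u
    by (rule hom_induced_hom)
  \<comment> \<open>A point is contractible, so homology relative to \<open>b\<close> is the reduced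
    homology; in it, pieces that are constantly \<open>b\<close> become trivial.\<close>
  have j: "?j \<in> iso ?R ?K"
    using b by (intro iso_reduced_homology_by_contractible) (auto simp: contractible_space_subtopology_singleton)
  interpret j: group_hom ?R ?K ?j
    using j unfolding group_hom_def group_hom_axioms_def iso_def by simp
  have injj: "inj_on ?j (carrier ?R)"
    using j by (simp add: iso_def bij_betw_def)
  \<comment> \<open>Homology relative to the equator is the direct sum of the contributions of the
    two hemispheres, by exactness for triples.\<close>
  have decomp: "\<exists>l u. l \<in> carrier (relative_homology_group n ?L ?E) \<and>
      u \<in> carrier (relative_homology_group n ?U ?E) \<and> c = ?iL l \<otimes>\<^bsub>?G\<^esub> ?iU u"
    if c: "c \<in> carrier ?G" for c
  proof -
    have "(\<lambda>(x, y). ?iL x \<otimes>\<^bsub>?G\<^esub> ?iU y)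
      \<in> iso (relative_homology_group n ?L ?E \<times>\<times> relative_homology_group n ?U ?E) ?G"
    proof (rule conjunct1 [OF exact_sequence_sum_lemma [OF abelian_relative_homology_group]])
      show "hom_induced n ?L ?E ?S {x. x n \<ge> 0} id
          \<in> iso (relative_homology_group n ?L ?E) (relative_homology_group n ?S {x. x n \<ge> 0})"
        using iso_relative_homology_group_lower_hemisphere by blast
      show "hom_induced n ?U ?E ?S {x. x n \<le> 0} id
          \<in> iso (relative_homology_group n ?U ?E) (relative_homology_group n ?S {x. x n \<le> 0})"
        using iso_relative_homology_group_upper_hemisphere by blast
      show "exact_seq ([relative_homology_group n ?S {x. x n \<le> 0}, ?G, relative_homology_group n ?L ?E],
           [hom_induced n ?S ?E ?S {x. x n \<le> 0} id, ?iL])"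
        by (rule homology_exactness_triple_3) force
      show "exact_seq ([relative_homology_group n ?S {x. x n \<ge> 0}, ?G, relative_homology_group n ?U ?E],
           [hom_induced n ?S ?E ?S {x. x n \<ge> 0} id, ?iU])"
        by (rule homology_exactness_triple_3) force
    next
      fix x
      show "hom_induced n ?S ?E ?S {x. x n \<ge> 0} id (?iL x) = hom_induced n ?L ?E ?S {x. x n \<ge> 0} id x"
        by (subst hom_induced_compose') auto
      show "hom_induced n ?S ?E ?S {x. x n \<le> 0} id (?iU x) = hom_induced n ?U ?E ?S {x. x n \<le> 0} id x"
        by (subst hom_induced_compose') auto
    qed
    then have "c \<in> (\<lambda>(x, y). ?iL x \<otimes>\<^bsub>?G\<^esub> ?iU y) `
        carrier (relative_homology_group n ?L ?E \<times>\<times> relative_homology_group n ?U ?E)"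
      using c by (simp add: iso_iff)
    then show ?thesis
      by auto
  qed
  have kU: "?k v (?iU u) = hom_induced n ?U ?E ?S {b} v u"
    if "continuous_map ?S ?S v" "v \<in> ?E \<rightarrow> {b}" for u v
    using hom_induced_compose'[of ?U ?S id ?E ?E ?S v "{b}" "int n" u, OF _ _ that] by simp
  have kL: "?k v (?iL u) = hom_induced n ?L ?E ?S {b} v u"
    if "continuous_map ?S ?S v" "v \<in> ?E \<rightarrow> {b}" for u v
    using hom_induced_compose'[of ?L ?S id ?E ?E ?S v "{b}" "int n" u, OF _ _ that] by simp
  \<comment> \<open>A map that is constantly \<open>b\<close> factors through the pair ({b}, {b}),
    whose relative homology is trivial.\<close>
  have triv: "hom_induced n X ?E ?S {b} v c = \<one>\<^bsub>?K\<^esub>"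
    if X: "\<And>x. x \<in> topspace X \<Longrightarrow> v x = b" and v: "continuous_map X ?S v" "v \<in> ?E \<rightarrow> {b}" for X v c
  proof -
    let ?P = "relative_homology_group n (subtopology ?S {b}) {b}"
    have P: "carrier ?P = {\<one>\<^bsub>?P\<^esub>}"
      using trivial_relative_homology_group_topspace[of n "subtopology ?S {b}"]
      unfolding topb trivial_group_def by simp
    have "continuous_map X (subtopology ?S {b}) v"
      using X v(1) by (intro continuous_map_into_subtopology) auto
    then have "hom_induced n X ?E ?S {b} v c =
        hom_induced n (subtopology ?S {b}) {b} ?S {b} id (hom_induced n X ?E (subtopology ?S {b}) {b} v c)"
      using hom_induced_compose'[of X "subtopology ?S {b}" v ?E "{b}" ?S id "{b}" "int n" c] v by simp
    also have "hom_induced n X ?E (subtopology ?S {b}) {b} v c = \<one>\<^bsub>?P\<^esub>"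
      using hom_induced_carrier[of n X ?E "subtopology ?S {b}" "{b}" v c] unfolding P by (rule singletonD)
    also have "hom_induced n (subtopology ?S {b}) {b} ?S {b} id \<one>\<^bsub>?P\<^esub> = \<one>\<^bsub>?K\<^esub>"
      by (meson hom_induced_hom hom_one group_relative_homology_group)
    finally show ?thesis .
  qed
  \<comment> \<open>On the lower summand \<open>h\<close> acts as \<open>g\<close> and
    \<open>f\<close> acts trivially; on the upper one the roles are exchanged.\<close>
  have add: "?k h c = ?k f c \<otimes>\<^bsub>?K\<^esub> ?k g c" if c: "c \<in> carrier ?G" for c
  proof -
    obtain l u where l: "l \<in> carrier (relative_homology_group n ?L ?E)"
      and u: "u \<in> carrier (relative_homology_group n ?U ?E)" and clu: "c = ?iL l \<otimes>\<^bsub>?G\<^esub> ?iU u"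
      using decomp[OF c] by blast
    have carr: "?iL l \<in> carrier ?G" "?iU u \<in> carrier ?G"
      by (simp_all add: hom_induced_carrier)
    have kk: "?k v c = ?k v (?iL l) \<otimes>\<^bsub>?K\<^esub> ?k v (?iU u)" for v
      unfolding clu using hom_mult[OF khom carr] .
    have "?k h (?iL l) = ?k g (?iL l)"
      unfolding kL[OF h mapsE(3)] kL[OF g mapsE(2)]
      by (rule fun_cong[OF hom_induced_eq]) (simp add: hg)
    moreover have "?k h (?iU u) = ?k f (?iU u)"
      unfolding kU[OF h mapsE(3)] kU[OF f mapsE(1)]
      by (rule fun_cong[OF hom_induced_eq]) (simp add: hf)
    moreover have "?k f (?iL l) = \<one>\<^bsub>?K\<^esub>"
      unfolding kL[OF f mapsE(1)]
      by (rule triv[OF _ continuous_map_from_subtopology[OF f] mapsE(1)]) (simp add: fb)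
    moreover have "?k g (?iU u) = \<one>\<^bsub>?K\<^esub>"
      unfolding kU[OF g mapsE(2)]
      by (rule triv[OF _ continuous_map_from_subtopology[OF g] mapsE(2)]) (simp add: gb)
    moreover have "?k g (?iL l) \<in> carrier ?K" "?k f (?iU u) \<in> carrier ?K"
      by (simp_all add: hom_induced_carrier)
    ultimately show ?thesis
      unfolding kk by (metis K.l_one K.r_one K.m_comm)
  qed
  fix c
  assume c: "c \<in> carrier ?R"
  let ?m = "\<lambda>f. hom_induced n ?S {} ?S {} f"
  have ec: "?e c \<in> carrier ?G"
    by (simp add: hom_induced_carrier)
  have ke: "?k v (?e c) = ?j (?m v c)" if "continuous_map ?S ?S v" "v \<in> ?E \<rightarrow> {b}" for v
    using hom_induced_compose'[of ?S ?S id "{}" ?E ?S v "{b}" "int n" c]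
      hom_induced_compose'[of ?S ?S v "{}" "{}" ?S id "{b}" "int n" c] that by simp
  have carr: "?m v c \<in> carrier ?R" for v
    using c by (rule hom_induced_reduced)
  have "?j (?m h c) = ?j (?m f c) \<otimes>\<^bsub>?K\<^esub> ?j (?m g c)"
    using add[OF ec] unfolding ke[OF f mapsE(1)] ke[OF g mapsE(2)] ke[OF h mapsE(3)] .
  also have "\<dots> = ?j (?m f c \<otimes>\<^bsub>?R\<^esub> ?m g c)"
    using j.hom_mult[OF carr carr] by simp
  finally have "?m h c = ?m f c \<otimes>\<^bsub>?R\<^esub> ?m g c"
    by (rule inj_onD[OF injj _ carr j.G.m_closed[OF carr carr]])
  also have "\<dots> = c [^]\<^bsub>?R\<^esub> Brouwer_degree2 n f \<otimes>\<^bsub>?R\<^esub> c [^]\<^bsub>?R\<^esub> Brouwer_degree2 n g"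
    using Brouwer_degree2[OF c] by simp
  also have "\<dots> = c [^]\<^bsub>?R\<^esub> (Brouwer_degree2 n f + Brouwer_degree2 n g)"
    using c by (simp add: j.G.int_pow_mult)
  finally show "?m h c = c [^]\<^bsub>?R\<^esub> (Brouwer_degree2 n f + Brouwer_degree2 n g)" .
qed

text \<open>Overwriting \<open>f\<close> and \<open>g\<close> by \<open>b\<close> on whole half
  spaces and gluing \<open>h\<close> anew changes nothing on the sphere and meets the pointwise
  conditions of \<open>Brouwer_degree2_pinch_aux\<close>.\<close>

lemma Brouwer_degree2_pinch:
  fixes f g :: "(nat \<Rightarrow> real) \<Rightarrow> nat \<Rightarrow> real"
  assumes "n > 0" and f: "continuous_map (nsphere n) (nsphere n) f"
    and g: "continuous_map (nsphere n) (nsphere n) g"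
    and h: "continuous_map (nsphere n) (nsphere n) h"
    and hf: "\<And>x. \<lbrakk>x \<in> topspace (nsphere n); x n \<ge> 0\<rbrakk> \<Longrightarrow> h x = f x"
    and hg: "\<And>x. \<lbrakk>x \<in> topspace (nsphere n); x n \<le> 0\<rbrakk> \<Longrightarrow> h x = g x"
    and fb: "\<And>x. \<lbrakk>x \<in> topspace (nsphere n); x n \<le> 0\<rbrakk> \<Longrightarrow> f x = b"
    and gb: "\<And>x. \<lbrakk>x \<in> topspace (nsphere n); x n \<ge> 0\<rbrakk> \<Longrightarrow> g x = b"
  shows "Brouwer_degree2 n h = Brouwer_degree2 n f + Brouwer_degree2 n g"
proof -
  define f' where "f' x = (if x n \<le> 0 then b else f x)" for x
  define g' where "g' x = (if x n \<ge> 0 then b else g x)" for x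
  define h' where "h' x = (if x n \<ge> 0 then f' x else g' x)" for x
  have eq: "f x = f' x" "g x = g' x" if "x \<in> topspace (nsphere n)" for x
    using fb[OF that] gb[OF that] by (simp_all add: f'_def g'_def)
  have eqh: "h x = h' x" if "x \<in> topspace (nsphere n)" for x
    using hf[OF that] hg[OF that] eq[OF that] by (simp add: h'_def)
  have "Brouwer_degree2 n h' = Brouwer_degree2 n f' + Brouwer_degree2 n g'"
  proof (rule Brouwer_degree2_pinch_aux[where b = b])
    show "continuous_map (nsphere n) (nsphere n) f'" "continuous_map (nsphere n) (nsphere n) g'"
      "continuous_map (nsphere n) (nsphere n) h'"
      by (rule continuous_map_eq[OF f eq(1)] continuous_map_eq[OF g eq(2)] continuous_map_eq[OF h eqh];
          assumption)+
  qed (use \<open>n > 0\<close> in \<open>auto simp: f'_def g'_def h'_def\<close>)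
  then show ?thesis
    using Brouwer_degree2_eq[OF eq(1)] Brouwer_degree2_eq[OF eq(2)] Brouwer_degree2_eq[OF eqh] by simp
qed

section \<open>Continuity of maps into complex numbers and spheres\<close>

lemma continuous_map_comp_on:
  assumes "continuous_map X euclidean f" and "\<And>x. x \<in> topspace X \<Longrightarrow> f x \<in> S" and "continuous_on S h"
  shows "continuous_map X euclidean (\<lambda>x. h (f x))"
proof -
  have "continuous_map X (top_of_set S) f"
    using assms by (auto simp: continuous_map_in_subtopology)
  moreover have "continuous_map (top_of_set S) euclidean h"
    using assms(3) by simp
  ultimately show ?thesis
    using continuous_map_compose[of X "top_of_set S" f euclidean h] by (simp add: o_def)
qed

lemma continuous_map_Pair_euclidean:
  assumes "continuous_map X euclidean f" "continuous_map X euclidean g"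
  shows "continuous_map X euclidean (\<lambda>x. (f x, g x))"
  using continuous_map_pairedI[OF assms] by simp

lemma continuous_map_Complex:
  assumes "continuous_map X euclideanreal f" "continuous_map X euclideanreal g"
  shows "continuous_map X euclidean (\<lambda>x. Complex (f x) (g x))"
  using continuous_map_comp_on[OF continuous_map_Pair_euclidean[OF assms], of UNIV "\<lambda>(a, b). Complex a b"]
  by (simp add: split_def continuous_intros)

lemma continuous_map_into_nsphere:
  assumes "\<And>i. i \<le> n \<Longrightarrow> continuous_map X euclideanreal (\<lambda>x. F x i)"
    and "\<And>x. x \<in> topspace X \<Longrightarrow> F x \<in> topspace (nsphere n)"
  shows "continuous_map X (nsphere n) F"
proof -
  have top: "topspace (nsphere n) = {x. (\<Sum>i\<le>n. x i ^ 2) = 1 \<and> (\<forall>i>n. x i = 0)}"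
    by (simp add: nsphere)
  have "continuous_map X euclideanreal (\<lambda>x. F x i)" for i
  proof (cases "i \<le> n")
    case False
    then have "F x i = 0" if "x \<in> topspace X" for x
      using assms(2)[OF that] unfolding top by simp
    then show ?thesis
      using continuous_map_eq[of X euclideanreal "\<lambda>x. 0" "\<lambda>x. F x i"] by simp
  qed (rule assms)
  then show ?thesis
    using assms(2) unfolding top
    by (auto simp: nsphere continuous_map_in_subtopology continuous_map_componentwise_UNIV)
qed

lemma topspace_nsphere_iff:
  "x \<in> topspace (nsphere n) \<longleftrightarrow> (\<Sum>i\<le>n. (x i)\<^sup>2) = 1 \<and> (\<forall>i>n. x i = 0)"
  by (simp add: nsphere)

section \<open>Powers on the circle\<close>

definition circle_map :: "(complex \<Rightarrow> complex) \<Rightarrow> (nat \<Rightarrow> real) \<Rightarrow> nat \<Rightarrow> real" where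
  "circle_map h x = (\<lambda>i. if i = 0 then Re (h (Complex (x 0) (x 1)))
     else if i = 1 then Im (h (Complex (x 0) (x 1))) else 0)"

lemma circle_map_cong:
  assumes "h (Complex (x 0) (x 1)) = h' (Complex (x 0) (x 1))"
  shows "circle_map h x = circle_map h' x"
  unfolding circle_map_def assms ..

lemma nsphere_1_circle:
  assumes "x \<in> topspace (nsphere 1)"
  shows "Complex (x 0) (x 1) \<in> sphere 0 1"
  using assms by (simp add: topspace_nsphere_iff cmod_def)

lemma continuous_map_nsphere_circle:
  "continuous_map (nsphere n) euclidean (\<lambda>x. Complex (x i) (x j))"
  by (intro continuous_map_Complex continuous_map_nsphere_projection)

lemma circle_map_in_nsphere:
  assumes "norm (h (Complex (x 0) (x 1))) = 1"
  shows "circle_map h x \<in> topspace (nsphere 1)"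
proof -
  have "(norm (h (Complex (x 0) (x 1))))\<^sup>2 = 1"
    using assms by simp
  then show ?thesis
    by (simp add: topspace_nsphere_iff circle_map_def cmod_power2)
qed

lemma homotopic_circle_map:
  fixes H :: "real \<Rightarrow> complex \<Rightarrow> complex"
  assumes cont: "continuous_on ({0..1} \<times> sphere 0 1) (\<lambda>(s, z). H s z)"
    and norm: "\<And>s z. \<lbrakk>s \<in> {0..1}; norm z = 1\<rbrakk> \<Longrightarrow> norm (H s z) = 1"
  shows "homotopic_with (\<lambda>x. True) (nsphere 1) (nsphere 1) (circle_map (H 0)) (circle_map (H 1))"
  unfolding homotopic_with_def
proof (intro exI conjI allI ballI)
  let ?X = "prod_topology (top_of_set {0..1}) (nsphere 1)"
  let ?c = "\<lambda>x::nat \<Rightarrow> real. Complex (x 0) (x 1)"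
  let ?K = "\<lambda>p. circle_map (H (fst p)) (snd p)"
  have cf: "continuous_map ?X euclidean (\<lambda>p. (fst p, ?c (snd p)))"
  proof (rule continuous_map_Pair_euclidean)
    show "continuous_map ?X euclidean fst"
      using continuous_map_fst[of "top_of_set {0..1}" "nsphere 1"] continuous_map_into_fulltopology
      by blast
    show "continuous_map ?X euclidean (\<lambda>p. ?c (snd p))"
      using continuous_map_compose[OF continuous_map_snd continuous_map_nsphere_circle]
      by (simp add: o_def)
  qed
  have in_S: "(fst p, ?c (snd p)) \<in> {0..1} \<times> sphere 0 1" if "p \<in> topspace ?X" for p
    using that nsphere_1_circle by (auto simp del: mem_sphere)
  have cH: "continuous_map ?X euclidean (\<lambda>p. H (fst p) (?c (snd p)))"
    using continuous_map_comp_on[OF cf in_S cont] by simp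
  show "continuous_map ?X (nsphere 1) ?K"
  proof (rule continuous_map_into_nsphere)
    fix i :: nat
    assume "i \<le> 1"
    then have "(\<lambda>p. ?K p i) = (\<lambda>p. Re (H (fst p) (?c (snd p)))) \<or> (\<lambda>p. ?K p i) = (\<lambda>p. Im (H (fst p) (?c (snd p))))"
      by (cases i) (auto simp: circle_map_def)
    then show "continuous_map ?X euclideanreal (\<lambda>p. ?K p i)"
      using continuous_map_comp_on[OF cH, of UNIV Re] continuous_map_comp_on[OF cH, of UNIV Im]
      by (auto simp: continuous_intros)
  next
    fix p :: "real \<times> (nat \<Rightarrow> real)"
    assume "p \<in> topspace ?X"
    then show "?K p \<in> topspace (nsphere 1)"
      using in_S[of p] by (intro circle_map_in_nsphere norm) auto
  qed
qed auto

text \<open>\<open>arccos (Re z)\<close> is the absolute value of the argument of z. Unlike the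
  argument it is continuous on the whole circle, which makes it usable in a homotopy.\<close>

lemma cis_arccos_Re:
  assumes "norm z = 1"
  shows "cis (arccos (Re z)) = (if Im z \<ge> 0 then z else cnj z)"
proof -
  have "\<bar>Re z\<bar> \<le> 1"
    using abs_Re_le_cmod[of z] assms by simp
  moreover have "sqrt (1 - (Re z)\<^sup>2) = \<bar>Im z\<bar>"
    using assms by (metis cmod_power2 add_diff_cancel_left' power_one real_sqrt_abs)
  ultimately show ?thesis
    by (auto simp: complex_eq_iff sin_arccos_abs)
qed

text \<open>\<open>z\<^bsup>k+1\<^esup>\<close> is deformed to \<open>\<psi>\<^sup>k \<psi>'\<close>, where \<open>\<psi>\<close> and \<open>\<psi>'\<close> are deformations of the identity that are
  constant on the lower and the upper half circle, respectively.\<close>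

theorem Brouwer_degree2_circle_power: "Brouwer_degree2 1 (circle_map (\<lambda>z. z ^ k)) = int k"
proof (induction k)
  case 0
  have "circle_map (\<lambda>z. z ^ 0) = (\<lambda>x i. if i = 0 then 1 else 0)"
    by (simp add: circle_map_def fun_eq_iff)
  then show ?case
    using Brouwer_degree2_const[of 1 "\<lambda>i. if i = 0 then 1 else 0"] by simp
next
  case (Suc k)
  \<comment> \<open>As \<open>arccos (Re z)\<close> is \<bar>arg z\<bar>, at s = 1 the first base is
    z^2 on the upper half circle and 1 on the lower; the minus sign exchanges the halves. At s = 0
    both bases are z.\<close>
  define H where "H a b s z = (z * cis (s * arccos (Re z))) ^ a * (z * cis (- (s * arccos (Re z)))) ^ b"
    for a b :: nat and s z
  have cont: "continuous_on ({0..1} \<times> sphere 0 1) (\<lambda>(s, z). H a b s z)" for a b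
  proof -
    have "- 1 \<le> Re z \<and> Re z \<le> 1" if "norm z = 1" for z
      using abs_Re_le_cmod[of z] that by auto
    then show ?thesis
      unfolding H_def split_def by (intro continuous_intros) auto
  qed
  have norm: "norm (H a b s z) = 1" if "norm z = 1" for a b s z
    using that by (simp add: H_def norm_mult norm_power)
  have hom: "homotopic_with (\<lambda>x. True) (nsphere 1) (nsphere 1) (circle_map (H a b 0)) (circle_map (H a b 1))" for a b
    by (rule homotopic_circle_map[OF cont norm])
  have cm: "continuous_map (nsphere 1) (nsphere 1) (circle_map (H a b 1))" for a b
    using homotopic_with_imp_continuous_maps[OF hom] by blast
  have H0: "H a b 0 = (\<lambda>z. z ^ (a + b))" for a b
    by (simp add: H_def power_add fun_eq_iff)
  have deg: "Brouwer_degree2 1 (circle_map (H a b 1)) = Brouwer_degree2 1 (circle_map (\<lambda>z. z ^ (a + b)))" for a b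
    using Brouwer_degree2_homotopic[OF hom[of a b]] unfolding H0 by simp
  have H1: "H a b 1 z = (if Im z \<ge> 0 then z\<^sup>2 else 1) ^ a * (if Im z \<le> 0 then z\<^sup>2 else 1) ^ b"
    if "norm z = 1" for a b z
  proof -
    have zz: "z * cnj z = 1"
      using that by (simp add: complex_norm_square[symmetric])
    have "cis (- arccos (Re z)) = cnj (cis (arccos (Re z)))"
      by (simp add: cis_cnj)
    then have "cis (- arccos (Re z)) = (if Im z \<ge> 0 then cnj z else z)"
      using cis_arccos_Re[OF that] by simp
    moreover have "cnj z = z" if "Im z = 0"
      using that by (simp add: complex_eq_iff)
    ultimately show ?thesis
      using cis_arccos_Re[OF that] zz by (cases "Im z" "0::real" rule: linorder_cases) (auto simp: H_def power2_eq_square)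
  qed
  have H1': "H a b 1 (Complex (x 0) (x 1)) =
      (if x 1 > 0 then (Complex (x 0) (x 1))\<^sup>2 ^ a else if x 1 < 0 then (Complex (x 0) (x 1))\<^sup>2 ^ b else 1)"
    if x: "x \<in> topspace (nsphere 1)" for a b x
  proof -
    \<comment> \<open>The seam of the two halves: 1 and -1 both have square 1, so all pieces meet in
      the value 1.\<close>
    have "(Complex (x 0) (x 1))\<^sup>2 = 1" if "x 1 = 0"
      using that x by (simp add: topspace_nsphere_iff complex_eq_iff power2_eq_square)
    then show ?thesis
      using H1[of "Complex (x 0) (x 1)" a b] nsphere_1_circle[OF x]
      by (cases "x 1" "0::real" rule: linorder_cases) simp_all
  qed
  have "Brouwer_degree2 1 (circle_map (H k 1 1)) =
      Brouwer_degree2 1 (circle_map (H k 0 1)) + Brouwer_degree2 1 (circle_map (H 0 1 1))"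
  proof (rule Brouwer_degree2_pinch[OF _ cm cm cm])
    let ?b = "circle_map (\<lambda>_. 1) (\<lambda>_. 0)"
    fix x
    assume x: "x \<in> topspace (nsphere 1)"
    have b: "?b = circle_map (\<lambda>_. 1) x"
      by (simp add: circle_map_def)
    show "circle_map (H k 1 1) x = circle_map (H k 0 1) x" if "x 1 \<ge> 0"
      by (rule circle_map_cong) (unfold H1'[OF x], use that in simp)
    show "circle_map (H k 1 1) x = circle_map (H 0 1 1) x" if "x 1 \<le> 0"
      by (rule circle_map_cong) (unfold H1'[OF x], use that in simp)
    show "circle_map (H k 0 1) x = ?b" if "x 1 \<le> 0"
      unfolding b by (rule circle_map_cong) (unfold H1'[OF x], use that in simp)
    show "circle_map (H 0 1 1) x = ?b" if "x 1 \<ge> 0"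
      unfolding b by (rule circle_map_cong) (unfold H1'[OF x], use that in simp)
  qed simp
  moreover have "Brouwer_degree2 1 (circle_map (\<lambda>z. z)) = 1"
  proof -
    have "Brouwer_degree2 1 (circle_map (\<lambda>z. z)) = Brouwer_degree2 1 id"
      by (rule Brouwer_degree2_eq) (auto simp: circle_map_def topspace_nsphere_iff fun_eq_iff)
    then show ?thesis
      by simp
  qed
  ultimately show ?case
    using Suc deg[of k 1] deg[of k 0] deg[of 0 1] by simp
qed

section \<open>Joins of spheres with the circle\<close>

text \<open>The cone over the k-th power map of the circle: unlike z^k it keeps the norm inside the
  disc, so replacing a pair of coordinates by it maps a sphere to itself.\<close>

definition sgn_power :: "nat \<Rightarrow> complex \<Rightarrow> complex" where
  "sgn_power k z = of_real (norm z) * sgn z ^ k"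

lemma norm_sgn_power [simp]: "norm (sgn_power k z) = norm z"
  by (cases "z = 0") (simp_all add: sgn_power_def norm_mult norm_power norm_sgn)

lemma sgn_power_unit: "norm z = 1 \<Longrightarrow> sgn_power k z = z ^ k"
  by (simp add: sgn_power_def sgn_div_norm)

lemma continuous_on_sgn_power: "continuous_on S (sgn_power k)"
proof -
  have "isCont (sgn_power k) z" for z
  proof (cases "z = 0")
    case True
    have "((\<lambda>w::complex. norm w) \<longlongrightarrow> 0) (at 0)"
      by (simp add: tendsto_norm_zero)
    then have "(sgn_power k \<longlongrightarrow> 0) (at 0)"
      by (rule tendsto_0_le[of _ _ _ 1]) simp
    then show ?thesis
      unfolding True isCont_def by (simp add: sgn_power_def[of _ 0])
  next
    case False
    then show ?thesis
      unfolding sgn_power_def by (intro continuous_intros) auto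
  qed
  then show ?thesis
    by (simp add: continuous_at_imp_continuous_on)
qed

text \<open>The join of the identity with the k-th power map of the circle in the coordinates
  \<open>i\<close> and \<open>Suc i\<close>.\<close>

definition pow_map :: "nat \<Rightarrow> nat \<Rightarrow> (nat \<Rightarrow> real) \<Rightarrow> nat \<Rightarrow> real" where
  "pow_map i k y = (\<lambda>j. if j = i then Re (sgn_power k (Complex (y i) (y (Suc i))))
     else if j = Suc i then Im (sgn_power k (Complex (y i) (y (Suc i)))) else y j)"

lemma pow_map_in_nsphere:
  assumes "Suc i \<le> n" "y \<in> topspace (nsphere n)"
  shows "pow_map i k y \<in> topspace (nsphere n)"
proof -
  let ?z = "Complex (y i) (y (Suc i))"
  have split: "(\<Sum>j\<le>n. g j) = g i + g (Suc i) + (\<Sum>j\<in>{..n} - {i, Suc i}. g j)" for g :: "nat \<Rightarrow> real"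
    using sum.subset_diff[of "{i, Suc i}" "{..n}" g] assms(1) by simp
  have "(Re (sgn_power k ?z))\<^sup>2 + (Im (sgn_power k ?z))\<^sup>2 = (y i)\<^sup>2 + (y (Suc i))\<^sup>2"
    using norm_sgn_power[of k ?z] by (simp add: cmod_power2[symmetric]) (simp add: cmod_power2)
  moreover have "(\<Sum>j\<in>{..n} - {i, Suc i}. (pow_map i k y j)\<^sup>2) = (\<Sum>j\<in>{..n} - {i, Suc i}. (y j)\<^sup>2)"
    by (rule sum.cong) (auto simp: pow_map_def)
  ultimately have "(\<Sum>j\<le>n. (pow_map i k y j)\<^sup>2) = (\<Sum>j\<le>n. (y j)\<^sup>2)"
    unfolding split by (simp add: pow_map_def)
  then show ?thesis
    using assms by (auto simp: topspace_nsphere_iff pow_map_def)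
qed

lemma continuous_map_pow_map:
  assumes "Suc i \<le> n"
  shows "continuous_map (nsphere n) (nsphere n) (pow_map i k)"
proof (rule continuous_map_into_nsphere)
  fix j
  have c: "continuous_map (nsphere n) euclidean (\<lambda>y. sgn_power k (Complex (y i) (y (Suc i))))"
    using continuous_map_comp_on[OF continuous_map_nsphere_circle _ continuous_on_sgn_power, of n i "Suc i" UNIV]
    by simp
  have "continuous_map (nsphere n) euclideanreal (\<lambda>y. Re (sgn_power k (Complex (y i) (y (Suc i)))))"
    "continuous_map (nsphere n) euclideanreal (\<lambda>y. Im (sgn_power k (Complex (y i) (y (Suc i)))))"
    using continuous_map_comp_on[OF c, of UNIV Re] continuous_map_comp_on[OF c, of UNIV Im]
    by (simp_all add: continuous_intros)
  then show "continuous_map (nsphere n) euclideanreal (\<lambda>y. pow_map i k y j)"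
    using continuous_map_nsphere_projection by (simp add: pow_map_def)
qed (rule pow_map_in_nsphere[OF assms])

text \<open>With the power in the first two coordinates, each further coordinate is a suspension
  coordinate, so the degree is the one on the circle.\<close>

lemma Brouwer_degree2_pow_map_0: "Brouwer_degree2 (Suc n) (pow_map 0 k) = int k"
proof (induction n)
  case 0
  have "Brouwer_degree2 (Suc 0) (pow_map 0 k) = Brouwer_degree2 (Suc 0) (circle_map (\<lambda>z. z ^ k))"
  proof (rule Brouwer_degree2_eq)
    fix x
    assume x: "x \<in> topspace (nsphere (Suc 0))"
    then have "sgn_power k (Complex (x 0) (x 1)) = Complex (x 0) (x 1) ^ k"
      using nsphere_1_circle[of x] by (intro sgn_power_unit) simp
    then show "pow_map 0 k x = circle_map (\<lambda>z. z ^ k) x"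
      using x by (auto simp: pow_map_def circle_map_def fun_eq_iff topspace_nsphere_iff)
  qed
  then show ?case
    using Brouwer_degree2_circle_power[of k] by simp
next
  case (Suc n)
  have "Brouwer_degree2 (Suc (Suc n)) (pow_map 0 k) = Brouwer_degree2 (Suc n) (pow_map 0 k)"
    by (rule Brouwer_degree2_suspension(2)[OF continuous_map_pow_map]) (simp_all add: pow_map_def)
  then show ?case
    using Suc by simp
qed

text \<open>The permutation of coordinates may reverse orientation, but it enters twice and its
  degree has square 1.\<close>

lemma Brouwer_degree2_coordinate_involution:
  assumes inv: "\<And>j. \<sigma> (\<sigma> j) = j" and le: "\<And>j. j \<le> n \<Longrightarrow> \<sigma> j \<le> n"
    and F: "continuous_map (nsphere n) (nsphere n) F"
  shows "Brouwer_degree2 n (\<lambda>y. F (y \<circ> \<sigma>) \<circ> \<sigma>) = Brouwer_degree2 n F"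
proof -
  let ?t = "\<lambda>y::nat \<Rightarrow> real. y \<circ> \<sigma>"
  have le': "\<sigma> j > n" if "j > n" for j
    using le[of "\<sigma> j"] inv[of j] that by (metis not_less)
  have t: "continuous_map (nsphere n) (nsphere n) ?t"
  proof (rule continuous_map_into_nsphere)
    show "continuous_map (nsphere n) euclideanreal (\<lambda>y. (y \<circ> \<sigma>) i)" for i
      by (simp add: continuous_map_nsphere_projection)
    fix y
    assume y: "y \<in> topspace (nsphere n)"
    have "(\<Sum>j\<le>n. ((y \<circ> \<sigma>) j)\<^sup>2) = (\<Sum>j\<le>n. (y j)\<^sup>2)"
      by (rule sum.reindex_bij_witness[of _ \<sigma> \<sigma>]) (auto simp: inv le)
    then show "y \<circ> \<sigma> \<in> topspace (nsphere n)"
      using y le' by (simp add: topspace_nsphere_iff)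
  qed
  have "?t \<circ> ?t = id"
    using inv by (simp add: fun_eq_iff)
  then have tt: "Brouwer_degree2 n ?t * Brouwer_degree2 n ?t = 1"
    using Brouwer_degree2_compose[OF t t] by simp
  have "Brouwer_degree2 n (?t \<circ> (F \<circ> ?t)) = Brouwer_degree2 n ?t * (Brouwer_degree2 n F * Brouwer_degree2 n ?t)"
    using Brouwer_degree2_compose[OF continuous_map_compose[OF t F] t] Brouwer_degree2_compose[OF t F]
    by simp
  then show ?thesis
    using tt by (simp add: o_def mult.left_commute)
qed

text \<open>The join puts the power into the last two coordinates, where suspension does not apply;
  they are swapped with the first two. The bound on \<open>i\<close> makes the two pairs disjoint,
  so that the swap is an involution.\<close>

lemma Brouwer_degree2_pow_map:
  assumes "i \<ge> 2"
  shows "Brouwer_degree2 (Suc i) (pow_map i k) = int k"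
proof -
  define \<sigma> where "\<sigma> j = (if j = 0 then i else if j = 1 then Suc i else if j = i then 0 else if j = Suc i then 1 else j)" for j
  have inv: "\<sigma> (\<sigma> j) = j" for j
    using assms by (auto simp: \<sigma>_def)
  have le: "\<sigma> j \<le> Suc i" if "j \<le> Suc i" for j
    using that by (auto simp: \<sigma>_def)
  have "(\<lambda>y. pow_map 0 k (y \<circ> \<sigma>) \<circ> \<sigma>) = pow_map i k"
  proof (intro ext)
    fix y j
    have iff: "\<sigma> j = 0 \<longleftrightarrow> j = i" "\<sigma> j = Suc 0 \<longleftrightarrow> j = Suc i"
      using assms by (auto simp: \<sigma>_def)
    have v: "\<sigma> 0 = i" "\<sigma> (Suc 0) = Suc i"
      by (simp_all add: \<sigma>_def)
    show "(pow_map 0 k (y \<circ> \<sigma>) \<circ> \<sigma>) j = pow_map i k y j"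
      unfolding pow_map_def o_apply iff v inv ..
  qed
  then show ?thesis
    using Brouwer_degree2_coordinate_involution[of \<sigma> "Suc i" "pow_map 0 k", OF inv le continuous_map_pow_map]
      Brouwer_degree2_pow_map_0[of i k] by simp
qed

section \<open>Join coordinates on S^{m+2}\<close>

abbreviation disc_sphere :: "nat \<Rightarrow> (complex \<times> (nat \<Rightarrow> real)) topology" where
  "disc_sphere m \<equiv> prod_topology (top_of_set (cball 0 1)) (nsphere m)"

text \<open>Parametrizes the join of S^m with the circle by the disc coordinate z. The factor in
  front of u vanishes exactly on the circle, so u is forgotten there and only there.\<close>

definition join_map :: "nat \<Rightarrow> complex \<Rightarrow> (nat \<Rightarrow> real) \<Rightarrow> nat \<Rightarrow> real" where
  "join_map m z u = (\<lambda>i. if i \<le> m then sqrt (1 - (norm z)\<^sup>2) * u i else if i = Suc m then Re z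
     else if i = Suc (Suc m) then Im z else 0)"

lemma join_map_in_nsphere:
  assumes "z \<in> cball 0 1" "u \<in> topspace (nsphere m)"
  shows "join_map m z u \<in> topspace (nsphere (m + 2))"
proof -
  have "(norm z)\<^sup>2 \<le> 1"
    using assms(1) by (simp add: abs_square_le_1)
  then have "(\<Sum>i\<le>m. (join_map m z u i)\<^sup>2) = 1 - (norm z)\<^sup>2"
    using assms(2) by (simp add: join_map_def power_mult_distrib topspace_nsphere_iff flip: sum_distrib_left)
  then show ?thesis
    by (simp add: topspace_nsphere_iff join_map_def cmod_power2)
qed

lemma continuous_map_join_map:
  "continuous_map (disc_sphere m) (nsphere (m + 2)) (\<lambda>(z, u). join_map m z u)"
proof (rule continuous_map_into_nsphere)
  have f: "continuous_map (disc_sphere m) euclidean fst"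
    using continuous_map_fst[of "top_of_set (cball 0 1)" "nsphere m"] continuous_map_into_fulltopology
    by blast
  have u: "continuous_map (disc_sphere m) euclideanreal (\<lambda>p. snd p i)" for i
    using continuous_map_compose[OF continuous_map_snd continuous_map_nsphere_projection] by (simp add: o_def)
  have r: "continuous_map (disc_sphere m) euclideanreal (\<lambda>p. sqrt (1 - (norm (fst p))\<^sup>2))"
    using continuous_map_comp_on[OF f, of UNIV "\<lambda>z. sqrt (1 - (norm z)\<^sup>2)"] by (simp add: continuous_intros)
  have "continuous_map (disc_sphere m) euclideanreal (\<lambda>p. Re (fst p))"
    "continuous_map (disc_sphere m) euclideanreal (\<lambda>p. Im (fst p))"
    using continuous_map_comp_on[OF f, of UNIV Re] continuous_map_comp_on[OF f, of UNIV Im]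
    by (simp_all add: continuous_intros)
  then show "continuous_map (disc_sphere m) euclideanreal (\<lambda>p. (case p of (z, u) \<Rightarrow> join_map m z u) i)" for i
    using continuous_map_real_mult[OF r u] by (simp add: join_map_def split_def)
qed (use join_map_in_nsphere in auto)

lemma join_map_surj:
  assumes y: "y \<in> topspace (nsphere (m + 2))"
  obtains z u where "z \<in> cball 0 1" "u \<in> topspace (nsphere m)" "y = join_map m z u"
proof -
  define z where "z = Complex (y (Suc m)) (y (Suc (Suc m)))"
  define r where "r = sqrt (1 - (norm z)\<^sup>2)"
  have s: "(\<Sum>i\<le>m. (y i)\<^sup>2) = 1 - (norm z)\<^sup>2" and gt: "\<And>i. i > m + 2 \<Longrightarrow> y i = 0"
    using y by (auto simp: topspace_nsphere_iff z_def cmod_power2)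
  have "(\<Sum>i\<le>m. (y i)\<^sup>2) \<ge> 0"
    by (rule sum_nonneg) simp
  then have nz: "(norm z)\<^sup>2 \<le> 1"
    using s by simp
  then have z1: "z \<in> cball 0 1"
    by (simp add: abs_square_le_1)
  have r2: "r\<^sup>2 = 1 - (norm z)\<^sup>2"
    using nz by (simp add: r_def)
  show thesis
  proof (cases "r = 0")
    \<comment> \<open>On the circle u is multiplied by 0, so any point of the sphere serves as
      preimage.\<close>
    case True
    then have "\<forall>i\<le>m. y i = 0"
      using s r2 by (simp add: sum_nonneg_eq_0_iff)
    then have "y = join_map m z (\<lambda>i. if i = 0 then 1 else 0)"
      using True gt unfolding r_def by (auto simp: join_map_def z_def fun_eq_iff le_Suc_eq not_le)
    then show thesis
      using that[OF z1 in_topspace_nsphere] by simp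
  next
    case False
    define u where "u i = (if i \<le> m then y i / r else 0)" for i
    have "(\<Sum>i\<le>m. (u i)\<^sup>2) = (\<Sum>i\<le>m. (y i)\<^sup>2) / r\<^sup>2"
      by (simp add: u_def power_divide sum_divide_distrib)
    then have "u \<in> topspace (nsphere m)"
      using False s unfolding r2[symmetric] by (simp add: topspace_nsphere_iff) (simp add: u_def)
    moreover have "y = join_map m z u"
      using False gt unfolding r_def[symmetric] join_map_def
      by (auto simp: z_def fun_eq_iff le_Suc_eq not_le u_def simp flip: r_def)
    ultimately show thesis
      using that[OF z1] by simp
  qed
qed

lemma join_map_eqD:
  assumes u: "u \<in> topspace (nsphere m)" "u' \<in> topspace (nsphere m)" and z: "z \<in> cball 0 1"
    and eq: "join_map m z u = join_map m z' u'"
  shows "z = z'" and "norm z = 1 \<or> u = u'"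
proof -
  have "join_map m z u i = join_map m z' u' i" for i
    using eq by simp
  from this[of "Suc m"] this[of "Suc (Suc m)"] show zz: "z = z'"
    by (simp add: join_map_def complex_eq_iff)
  have "u = u'" if "norm z \<noteq> 1"
  proof
    fix i
    have "norm z < 1"
      using that z by simp
    then have "(norm z)\<^sup>2 < 1"
      by (simp add: abs_square_less_1)
    then have "sqrt (1 - (norm z)\<^sup>2) \<noteq> 0"
      by simp
    then show "u i = u' i"
      using \<open>join_map m z u i = join_map m z' u' i\<close> u zz
      by (cases "i \<le> m") (auto simp: join_map_def topspace_nsphere_iff)
  qed
  then show "norm z = 1 \<or> u = u'"
    by blast
qed

lemma join_map_image: "(\<lambda>(z, u). join_map m z u) ` topspace (disc_sphere m) = topspace (nsphere (m + 2))"
proof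
  show "(\<lambda>(z, u). join_map m z u) ` topspace (disc_sphere m) \<subseteq> topspace (nsphere (m + 2))"
    using continuous_map_image_subset_topspace[OF continuous_map_join_map] by blast
  show "topspace (nsphere (m + 2)) \<subseteq> (\<lambda>(z, u). join_map m z u) ` topspace (disc_sphere m)"
  proof
    fix y
    assume "y \<in> topspace (nsphere (m + 2))"
    then obtain z u where zu: "z \<in> cball 0 1" "u \<in> topspace (nsphere m)" "y = join_map m z u"
      by (rule join_map_surj)
    show "y \<in> (\<lambda>(z, u). join_map m z u) ` topspace (disc_sphere m)"
      unfolding zu(3) using zu(1,2) by (intro image_eqI[of _ _ "(z, u)"]) simp_all
  qed
qed

text \<open>A closed subset of the compact cube of all sequences in [-1, 1]. Compactness is what
  turns \<open>join_map\<close> into a quotient map.\<close>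

lemma compact_space_nsphere: "compact_space (nsphere n)"
proof -
  let ?S = "{x::nat \<Rightarrow> real. (\<Sum>i\<le>n. (x i)\<^sup>2) = 1 \<and> (\<forall>i>n. x i = 0)}"
  have sq: "?S \<subseteq> PiE UNIV (\<lambda>_. {-1..1})"
  proof
    fix x
    assume "x \<in> ?S"
    then have "x \<in> topspace (nsphere n)"
      by (simp add: topspace_nsphere_iff)
    then show "x \<in> PiE UNIV (\<lambda>_. {-1..1})"
      using topspace_nsphere_1[of x n] by (auto simp: abs_square_le_1 abs_le_iff minus_le_iff)
  qed
  have comp: "compactin (powertop_real UNIV) (PiE UNIV (\<lambda>_. {-1..1}))"
    by (simp add: compactin_PiE)
  have proj: "continuous_map (powertop_real UNIV) euclideanreal (\<lambda>x. x i)" for i :: nat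
    by (rule continuous_map_product_projection) simp
  have "closedin (powertop_real UNIV) {x \<in> topspace (powertop_real UNIV). (\<Sum>i\<le>n. (x i)\<^sup>2) \<in> {1}}"
    by (rule closedin_continuous_map_preimage[of _ euclideanreal])
      (auto intro!: continuous_intros proj simp: power2_eq_square)
  moreover have "closedin (powertop_real UNIV) (\<Inter>j\<in>UNIV. {x \<in> topspace (powertop_real UNIV). x (Suc (n + j)) \<in> {0::real}})"
    by (intro closedin_INT closedin_continuous_map_preimage[of _ euclideanreal] proj) auto
  ultimately have "closedin (powertop_real UNIV)
      ({x \<in> topspace (powertop_real UNIV). (\<Sum>i\<le>n. (x i)\<^sup>2) \<in> {1}} \<inter>
       (\<Inter>j\<in>UNIV. {x \<in> topspace (powertop_real UNIV). x (Suc (n + j)) \<in> {0::real}}))"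
    by blast
  also have "\<dots> = ?S"
    by (auto simp: less_iff_Suc_add)
  finally have "compactin (powertop_real UNIV) ?S"
    using closed_compactin[OF comp sq] by blast
  then show ?thesis
    unfolding nsphere by (rule compact_space_subtopology)
qed

lemma Hausdorff_space_nsphere: "Hausdorff_space (nsphere n)"
  unfolding nsphere_def by (intro Hausdorff_space_subtopology Hausdorff_Euclidean_space)

lemma quotient_map_compact_Hausdorff:
  assumes "compact_space X" "Hausdorff_space Y" "continuous_map X Y f" "f ` topspace X = topspace Y"
  shows "quotient_map X Y f"
  using assms by (intro continuous_closed_imp_quotient_map continuous_imp_closed_map_gen Hausdorff_imp_kc_space)

lemma compact_space_disc_sphere: "compact_space (disc_sphere m)"
  by (simp add: compact_space_prod_topology compact_space_nsphere compact_space_subtopology)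

text \<open>\<open>join_map\<close> is a continuous surjection from a compact onto a Hausdorff
  space, hence a quotient map; by \<open>join_map_eqD\<close> distinct points are identified only
  over the same z on the circle, which is what \<open>const\<close> covers.\<close>

lemma join_map_descend:
  assumes h: "continuous_map (disc_sphere m) Y (\<lambda>(z, u). h z u)"
    and const: "\<And>z u u'. \<lbrakk>norm z = 1; u \<in> topspace (nsphere m); u' \<in> topspace (nsphere m)\<rbrakk> \<Longrightarrow> h z u = h z u'"
  obtains F where "continuous_map (nsphere (m + 2)) Y F"
    and "\<And>z u. \<lbrakk>z \<in> cball 0 1; u \<in> topspace (nsphere m)\<rbrakk> \<Longrightarrow> F (join_map m z u) = h z u"
proof -
  let ?j = "\<lambda>(z, u). join_map m z u"
  have quo: "quotient_map (disc_sphere m) (nsphere (m + 2)) ?j"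
    by (intro quotient_map_compact_Hausdorff compact_space_disc_sphere Hausdorff_space_nsphere
        continuous_map_join_map join_map_image)
  have lift: "(\<lambda>(z, u). h z u) x = (\<lambda>(z, u). h z u) y"
    if "x \<in> topspace (disc_sphere m)" "y \<in> topspace (disc_sphere m)" and eq: "?j x = ?j y" for x y
  proof -
    have zu: "fst x \<in> cball 0 1" "snd x \<in> topspace (nsphere m)" "snd y \<in> topspace (nsphere m)"
      using that(1,2) by (simp_all add: mem_Times_iff)
    show ?thesis
      using join_map_eqD[OF zu(2,3,1), of "fst y"] const[OF _ zu(2,3), of "fst x"] eq
      by (auto simp: split_def)
  qed
  obtain F where F: "continuous_map (nsphere (m + 2)) Y F"
    "\<And>x. x \<in> topspace (disc_sphere m) \<Longrightarrow> F (?j x) = (\<lambda>(z, u). h z u) x"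
    by (rule quotient_map_lift_exists[OF quo h], (rule lift; assumption), rule that)
  show thesis
  proof (rule that[OF F(1)])
    show "F (join_map m z u) = h z u" if "z \<in> cball 0 1" "u \<in> topspace (nsphere m)" for z u
      using F(2)[of "(z, u)"] that by simp
  qed
qed

text \<open>Homotopies also descend, since \<open>id \<times> join_map\<close> is a quotient map.\<close>

lemma join_map_homotopic:
  assumes h: "continuous_map (prod_topology (top_of_set {0..1}) (disc_sphere m)) (nsphere (m + 2))
      (\<lambda>(s, z, u). h s z u)"
    and const: "\<And>s z u u'. \<lbrakk>s \<in> {0..1::real}; norm z = 1; u \<in> topspace (nsphere m); u' \<in> topspace (nsphere m)\<rbrakk>
        \<Longrightarrow> h s z u = h s z u'"
    and F: "\<And>z u. \<lbrakk>z \<in> cball 0 1; u \<in> topspace (nsphere m)\<rbrakk> \<Longrightarrow> F (join_map m z u) = h 0 z u"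
    and G: "\<And>z u. \<lbrakk>z \<in> cball 0 1; u \<in> topspace (nsphere m)\<rbrakk> \<Longrightarrow> G (join_map m z u) = h 1 z u"
  shows "homotopic_with (\<lambda>_. True) (nsphere (m + 2)) (nsphere (m + 2)) F G"
proof -
  let ?X = "prod_topology (top_of_set {0..1::real}) (disc_sphere m)"
  let ?Y = "prod_topology (top_of_set {0..1::real}) (nsphere (m + 2))"
  let ?j = "\<lambda>(s, z, u). (s, join_map m z u)"
  have jj: "?j = (\<lambda>p. (fst p, (\<lambda>(z, u). join_map m z u) (snd p)))"
    by auto
  have quo: "quotient_map ?X ?Y ?j"
  proof (rule quotient_map_compact_Hausdorff)
    show "compact_space ?X"
      using compact_space_disc_sphere[of m]
      by (subst compact_space_prod_topology) (simp add: compact_space_subtopology)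
    show "Hausdorff_space ?Y"
      by (subst Hausdorff_space_prod_topology) (simp add: Hausdorff_space_nsphere Hausdorff_space_subtopology)
    show "continuous_map ?X ?Y ?j"
      unfolding jj
      using continuous_map_compose[OF continuous_map_snd continuous_map_join_map[of m]]
      by (intro continuous_map_pairedI continuous_map_fst) (simp add: o_def)
    have "?j ` topspace ?X = {0..1} \<times> (\<lambda>(z, u). join_map m z u) ` topspace (disc_sphere m)"
      unfolding jj by (force simp: image_iff)
    then show "?j ` topspace ?X = topspace ?Y"
      unfolding join_map_image by simp
  qed
  have lift: "(\<lambda>(s, z, u). h s z u) x = (\<lambda>(s, z, u). h s z u) y"
    if "x \<in> topspace ?X" "y \<in> topspace ?X" and eq: "?j x = ?j y" for x y
  proof -
    have zu: "fst x \<in> {0..1}" "fst (snd x) \<in> cball 0 1"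
      "snd (snd x) \<in> topspace (nsphere m)" "snd (snd y) \<in> topspace (nsphere m)"
      using that(1,2) by (simp_all add: mem_Times_iff)
    show ?thesis
      using join_map_eqD[OF zu(3,4,2), of "fst (snd y)"] const[OF zu(1) _ zu(3,4), of "fst (snd x)"] eq
      by (auto simp: split_def)
  qed
  obtain H where H: "continuous_map ?Y (nsphere (m + 2)) H"
    "\<And>x. x \<in> topspace ?X \<Longrightarrow> H (?j x) = (\<lambda>(s, z, u). h s z u) x"
    by (rule quotient_map_lift_exists[OF quo h], (rule lift; assumption), rule that)
  have H': "H (s, join_map m z u) = h s z u"
    if "s \<in> {0..1}" "z \<in> cball 0 1" "u \<in> topspace (nsphere m)" for s z u
    using H(2)[of "(s, z, u)"] that by simp
  have "H (0, y) = F y" "H (1, y) = G y" if "y \<in> topspace (nsphere (m + 2))" for y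
    using join_map_surj[OF that] H' F G by (metis atLeastAtMost_iff zero_le_one order_refl)+
  then show ?thesis
    using H(1) by (subst homotopic_with) auto
qed

text \<open>\<Psi> is the power map in the last two coordinates after the double suspension
  \<open>S\<close> of \<phi>. Suspension keeps the degree of \<phi>, and degrees multiply under
  composition. From m \<ge> 1 comes the bound needed for the degree of
  \<open>pow_map (Suc m) k\<close>.\<close>

lemma Brouwer_degree2_join_power:
  assumes "m \<ge> 1" and \<phi>: "continuous_map (nsphere m) (nsphere m) \<phi>"
    and \<Psi>: "\<And>z u. \<lbrakk>z \<in> cball 0 1; u \<in> topspace (nsphere m)\<rbrakk>
        \<Longrightarrow> \<Psi> (join_map m z u) = join_map m (sgn_power k z) (\<phi> u)"
  shows "Brouwer_degree2 (m + 2) \<Psi> = int k * Brouwer_degree2 m \<phi>"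
proof -
  have \<phi>im: "\<phi> u \<in> topspace (nsphere m)" if "u \<in> topspace (nsphere m)" for u
    using continuous_map_image_subset_topspace[OF \<phi>] that by blast
  have "continuous_map (disc_sphere m) (disc_sphere m) (\<lambda>p. (fst p, \<phi> (snd p)))"
    using continuous_map_compose[OF continuous_map_snd \<phi>]
    by (intro continuous_map_pairedI continuous_map_fst) (simp add: o_def)
  then have "continuous_map (disc_sphere m) (nsphere (m + 2)) (\<lambda>(z, u). join_map m z (\<phi> u))"
    using continuous_map_compose[OF _ continuous_map_join_map] by (fastforce simp: o_def split_def)
  then obtain S where S: "continuous_map (nsphere (m + 2)) (nsphere (m + 2)) S"
    and Sj: "\<And>z u. \<lbrakk>z \<in> cball 0 1; u \<in> topspace (nsphere m)\<rbrakk> \<Longrightarrow> S (join_map m z u) = join_map m z (\<phi> u)"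
    by (rule join_map_descend) (auto simp: join_map_def)
  have keep: "S y (Suc m) = y (Suc m)" "S y (Suc (Suc m)) = y (Suc (Suc m))"
    if "y \<in> topspace (nsphere (m + 2))" for y
    using join_map_surj[OF that] Sj by (metis (no_types, lifting) join_map_def Suc_n_not_le_n n_not_Suc_n Suc_leD)+
  have S': "continuous_map (nsphere (Suc (Suc m))) (nsphere (Suc (Suc m))) S"
    using S by simp
  have sub: "topspace (nsphere (Suc m)) \<subseteq> topspace (nsphere (m + 2))"
    by (auto simp: topspace_nsphere_iff)
  have S1: "continuous_map (nsphere (Suc m)) (nsphere (Suc m)) S"
    "Brouwer_degree2 (Suc (Suc m)) S = Brouwer_degree2 (Suc m) S"
    using Brouwer_degree2_suspension[OF S'] keep by simp_all
  have "Brouwer_degree2 (m + 2) S = Brouwer_degree2 m S"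
    using Brouwer_degree2_suspension(2)[OF S1(1)] S1(2) keep(1) sub by auto
  also have "\<dots> = Brouwer_degree2 m \<phi>"
  proof (rule Brouwer_degree2_eq)
    fix u
    assume u: "u \<in> topspace (nsphere m)"
    \<comment> \<open>The points with z = 0 form the copy of S^m on which \<open>S\<close> is
      \<phi>.\<close>
    have j0: "join_map m 0 v = v" if "v \<in> topspace (nsphere m)" for v
      using that by (auto simp: join_map_def topspace_nsphere_iff fun_eq_iff)
    show "S u = \<phi> u"
      using Sj[of 0 u] j0[OF u] j0[OF \<phi>im[OF u]] u by simp
  qed
  finally have degS: "Brouwer_degree2 (m + 2) S = Brouwer_degree2 m \<phi>" .
  have pc: "continuous_map (nsphere (m + 2)) (nsphere (m + 2)) (pow_map (Suc m) k)"
    by (rule continuous_map_pow_map) simp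
  have "Brouwer_degree2 (m + 2) \<Psi> = Brouwer_degree2 (m + 2) (pow_map (Suc m) k \<circ> S)"
  proof (rule Brouwer_degree2_eq)
    fix y
    assume "y \<in> topspace (nsphere (m + 2))"
    then obtain z u where zu: "z \<in> cball 0 1" "u \<in> topspace (nsphere m)" "y = join_map m z u"
      by (rule join_map_surj)
    show "\<Psi> y = (pow_map (Suc m) k \<circ> S) y"
      unfolding zu(3) o_apply \<Psi>[OF zu(1,2)] Sj[OF zu(1,2)]
      by (auto simp: join_map_def pow_map_def fun_eq_iff)
  qed
  also have "\<dots> = int k * Brouwer_degree2 m \<phi>"
    using Brouwer_degree2_compose[OF S pc] degS Brouwer_degree2_pow_map[of "Suc m" k] \<open>m \<ge> 1\<close> by simp
  finally show ?thesis .
qed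

section \<open>Discs in spheres of dimension at least three\<close>

text \<open>The dimension of \<open>B\<close> does not exceed that of the sphere, so there is no
  obstruction to extending from a closed subset; the cell complex consists of the single cell
  \<open>B\<close>.\<close>

lemma extend_map_polytope_to_sphere:
  fixes f :: "'a::euclidean_space \<Rightarrow> 'b::euclidean_space"
  assumes "polytope B" "S \<subseteq> B" "closed S" and dim: "DIM('a) < DIM('b)"
    and "continuous_on S f" "\<And>x. x \<in> S \<Longrightarrow> norm (f x) = 1"
  obtains g where "continuous_on B g" "\<And>x. x \<in> B \<Longrightarrow> norm (g x) = 1" "\<And>x. x \<in> S \<Longrightarrow> g x = f x"
proof -
  have aff: "aff_dim B < aff_dim (cball 0 1 :: 'b set)"
    using aff_dim_le_DIM[of B] dim by (simp add: aff_dim_cball)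
  show thesis
  proof (rule extend_map_cell_complex_to_sphere[of "{B}" S "cball 0 1" f])
    fix g
    assume "continuous_on (\<Union>{B}) g" "g \<in> \<Union>{B} \<rightarrow> rel_frontier (cball 0 1)" "\<And>x. x \<in> S \<Longrightarrow> g x = f x"
    then show thesis
      by (intro that[of g]) auto
  qed (use assms aff in \<open>auto simp: face_of_refl polytope_imp_convex\<close>)
qed

text \<open>The homotopy is prescribed on the lids and the side of the cylinder [0,1] x D^2, which
  lies in a 3-dimensional box; maps into the 3-sphere extend over that box.\<close>

lemma disc_homotopy_S3:
  fixes p0 p1 :: "complex \<Rightarrow> complex \<times> complex"
  assumes c0: "continuous_on (cball 0 1) p0" and c1: "continuous_on (cball 0 1) p1"
    and n0: "\<And>z. z \<in> cball 0 1 \<Longrightarrow> norm (p0 z) = 1" and n1: "\<And>z. z \<in> cball 0 1 \<Longrightarrow> norm (p1 z) = 1"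
    and eq: "\<And>z. norm z = 1 \<Longrightarrow> p0 z = p1 z"
  obtains H :: "real \<times> complex \<Rightarrow> complex \<times> complex"
  where "continuous_on ({0..1} \<times> cball 0 1) H"
    and "\<And>s z. \<lbrakk>s \<in> {0..1}; z \<in> cball 0 1\<rbrakk> \<Longrightarrow> norm (H (s, z)) = 1"
    and "\<And>z. z \<in> cball 0 1 \<Longrightarrow> H (0, z) = p0 z" and "\<And>z. z \<in> cball 0 1 \<Longrightarrow> H (1, z) = p1 z"
    and "\<And>s z. \<lbrakk>s \<in> {0..1}; norm z = 1\<rbrakk> \<Longrightarrow> H (s, z) = p0 z"
proof -
  define S :: "(real \<times> complex) set" where "S = {0, 1} \<times> cball 0 1 \<union> {0..1} \<times> sphere 0 1"
  \<comment> \<open>On \<open>S\<close> this is p0 on one lid, p1 on the other and their common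
    value on the side, hence of norm 1. One formula on the whole cylinder gives continuity without
    gluing.\<close>
  define f where "f = (\<lambda>(s, z). (1 - s) *\<^sub>R p0 z + s *\<^sub>R p1 z)"
  let ?B = "cbox (0, Complex (-1) (-1)) (1, Complex 1 1) :: (real \<times> complex) set"
  have SC: "S \<subseteq> {0..1} \<times> cball 0 1"
    by (auto simp: S_def)
  have CB: "{0..1} \<times> cball 0 1 \<subseteq> ?B"
  proof -
    have "z \<in> cbox (Complex (-1) (-1)) (Complex 1 1)" if "norm z \<le> 1" for z
      using abs_Re_le_cmod[of z] abs_Im_le_cmod[of z] that by (simp add: in_cbox_complex_iff) linarith
    then show ?thesis
      by (auto simp: cbox_Pair_eq)
  qed
  have f0: "f (0, z) = p0 z" and f1: "f (1, z) = p1 z" for z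
    by (simp_all add: f_def)
  have fb: "f (s, z) = p0 z" if "norm z = 1" for s z
    using eq[OF that] by (simp add: f_def flip: scaleR_add_left)
  have contf: "continuous_on S f"
  proof -
    have "continuous_on ({0..1::real} \<times> cball 0 1) (\<lambda>x. p (snd x))"
      if "continuous_on (cball 0 1) p" for p :: "complex \<Rightarrow> complex \<times> complex"
      by (rule continuous_on_compose2[OF that continuous_on_snd[OF continuous_on_id]]) auto
    from this[OF c0] this[OF c1] have "continuous_on ({0..1} \<times> cball 0 1) f"
      unfolding f_def split_def by (intro continuous_intros)
    then show ?thesis
      using SC continuous_on_subset by blast
  qed
  have fim: "norm (f x) = 1" if "x \<in> S" for x
  proof -
    obtain s z where "x = (s, z)" "s = 0 \<or> s = 1 \<or> norm z = 1" "norm z \<le> 1"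
      using \<open>x \<in> S\<close> by (auto simp: S_def)
    then show ?thesis
      using f0 f1 fb n0[of z] n1[of z] by auto
  qed
  have "closed S"
    unfolding S_def by (intro closed_Un closed_Times) (auto intro: finite_imp_closed)
  then obtain g where g: "continuous_on ?B g" "\<And>x. x \<in> ?B \<Longrightarrow> norm (g x) = 1"
      "\<And>x. x \<in> S \<Longrightarrow> g x = f x"
    using extend_map_polytope_to_sphere[OF polytope_interval order_trans[OF SC CB] _ _ contf fim]
    by auto
  show thesis
  proof (rule that[of g])
    show "continuous_on ({0..1} \<times> cball 0 1) g"
      using g(1) CB continuous_on_subset by blast
    show "norm (g (s, z)) = 1" if "s \<in> {0..1}" "z \<in> cball 0 1" for s z
      using that CB by (intro g(2)) blast
    show "g (0, z) = p0 z" "g (1, z) = p1 z" if "z \<in> cball 0 1" for z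
      using g(3)[of "(0, z)"] g(3)[of "(1, z)"] f0 f1 that by (auto simp: S_def)
    show "g (s, z) = p0 z" if "s \<in> {0..1}" "norm z = 1" for s z
      using g(3)[of "(s, z)"] fb that by (auto simp: S_def)
  qed
qed

text \<open>\<open>p\<close> may have zeros, so it is normalized only on the closed set where its
  norm is at least 1/2, where the division is continuous; the result extends since the disc has
  dimension below 3.\<close>

lemma disc_map_normalize_S3:
  fixes p :: "complex \<Rightarrow> complex \<times> complex"
  assumes c: "continuous_on (cball 0 1) p"
  obtains e where "continuous_on (cball 0 1) e" and "\<And>z. z \<in> cball 0 1 \<Longrightarrow> norm (e z) = 1"
    and "\<And>z. \<lbrakk>z \<in> cball 0 1; norm (p z) \<ge> 1 / 2\<rbrakk> \<Longrightarrow> e z = p z /\<^sub>R norm (p z)"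
proof -
  define S where "S = {z \<in> cball 0 1. norm (p z) \<ge> 1 / 2}"
  let ?B = "cbox (Complex (-1) (-1)) (Complex 1 1)"
  have CB: "cball 0 1 \<subseteq> ?B"
  proof
    fix z :: complex
    assume "z \<in> cball 0 1"
    then show "z \<in> ?B"
      using abs_Re_le_cmod[of z] abs_Im_le_cmod[of z] by (simp add: in_cbox_complex_iff) linarith
  qed
  have S: "S \<subseteq> cball 0 1"
    by (auto simp: S_def)
  have "closed S"
    unfolding S_def using c by (intro continuous_on_closed_Collect_le continuous_intros) auto
  have contf: "continuous_on S (\<lambda>z. p z /\<^sub>R norm (p z))"
    using continuous_on_subset[OF c S] by (auto intro!: continuous_intros simp: S_def)
  have fim: "norm (p z /\<^sub>R norm (p z)) = 1" if "z \<in> S" for z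
  proof -
    have "norm (p z) \<noteq> 0"
      using that by (auto simp: S_def)
    then show ?thesis
      by simp
  qed
  from \<open>closed S\<close> obtain g where g: "continuous_on ?B g" "\<And>x. x \<in> ?B \<Longrightarrow> norm (g x) = 1"
      "\<And>x. x \<in> S \<Longrightarrow> g x = p x /\<^sub>R norm (p x)"
    using extend_map_polytope_to_sphere[OF polytope_interval order_trans[OF S CB] _ _ contf fim]
    by auto
  show thesis
  proof (rule that[of g])
    show "continuous_on (cball 0 1) g"
      using g(1) CB continuous_on_subset by blast
    show "norm (g z) = 1" if "z \<in> cball 0 1" for z
      using that CB by (intro g(2)) blast
    show "g z = p z /\<^sub>R norm (p z)" if "z \<in> cball 0 1" "norm (p z) \<ge> 1 / 2" for z
      using g(3) that by (simp add: S_def)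
  qed
qed

text \<open>\<open>W\<close> is a homotopy relative to the boundary between two discs \<open>v\<close> and \<open>w\<close> in the unit sphere of
  \<open>\<complex>\<^bsup>k+1\<^esup>\<close>, whose points are functions restricted to \<open>{..k}\<close>.\<close>

definition disc_path :: "nat \<Rightarrow> (complex \<Rightarrow> nat \<Rightarrow> complex) \<Rightarrow> (complex \<Rightarrow> nat \<Rightarrow> complex) \<Rightarrow>
    (real \<times> complex \<Rightarrow> nat \<Rightarrow> complex) \<Rightarrow> bool" where
  "disc_path k v w W \<longleftrightarrow>
     (\<forall>i\<le>k. continuous_on ({0..1} \<times> cball 0 1) (\<lambda>p. W p i)) \<and>
     (\<forall>s\<in>{0..1}. \<forall>z\<in>cball 0 1. (\<Sum>i\<le>k. (norm (W (s, z) i))\<^sup>2) = 1) \<and>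
     (\<forall>z\<in>cball 0 1. \<forall>i\<le>k. W (0, z) i = v z i \<and> W (1, z) i = w z i) \<and>
     (\<forall>s\<in>{0..1}. \<forall>z\<in>sphere 0 1. \<forall>i\<le>k. W (s, z) i = v z i)"

definition last_two :: "nat \<Rightarrow> complex \<times> complex \<Rightarrow> nat \<Rightarrow> complex" where
  "last_two j p = (\<lambda>i. if i = j then fst p else if i = Suc j then snd p else 0)"

lemma sum_atMost_split_last_two:
  fixes g :: "nat \<Rightarrow> real"
  shows "(\<Sum>i\<le>Suc j. g i) = (\<Sum>i<j. g i) + g j + g (Suc j)"
proof -
  have "(\<Sum>i\<le>j. g i) = (\<Sum>i<Suc j. g i)"
    by (simp only: lessThan_Suc_atMost)
  then show ?thesis
    by simp
qed

lemma sum_norm_last_two: "(\<Sum>i\<le>Suc j. (norm (last_two j p i))\<^sup>2) = (norm p)\<^sup>2"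
proof -
  have "(\<Sum>i<j. (norm (last_two j p i))\<^sup>2) = 0"
    by (simp add: last_two_def)
  moreover have "(norm p)\<^sup>2 = (norm (fst p))\<^sup>2 + (norm (snd p))\<^sup>2"
    by (cases p) (simp add: norm_Pair)
  ultimately show ?thesis
    unfolding sum_atMost_split_last_two by (simp add: last_two_def)
qed

text \<open>The pair \<open>p\<close> of the last two coordinates may vanish. Where \<open>norm p\<close> is at least \<open>1/2\<close>, normalizing it gives
  a map to the 3-sphere, which extends to a map \<open>e\<close> on the whole disc; elsewhere the other coordinates of \<open>v\<close>
  do not all vanish, so the segment from \<open>v\<close> to \<open>e\<close> avoids \<open>0\<close>.\<close>

lemma disc_path_into_last_two:
  fixes v :: "complex \<Rightarrow> nat \<Rightarrow> complex"
  assumes cont: "\<And>i. i \<le> Suc j \<Longrightarrow> continuous_on (cball 0 1) (\<lambda>z. v z i)"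
    and unit: "\<And>z. z \<in> cball 0 1 \<Longrightarrow> (\<Sum>i\<le>Suc j. (norm (v z i))\<^sup>2) = 1"
    and bdry: "\<And>z i. \<lbrakk>norm z = 1; i < j\<rbrakk> \<Longrightarrow> v z i = 0"
  obtains e W where "continuous_on (cball 0 1) e" "\<And>z. z \<in> cball 0 1 \<Longrightarrow> norm (e z) = 1"
    "\<And>z. norm z = 1 \<Longrightarrow> e z = (v z j, v z (Suc j))"
    "disc_path (Suc j) v (\<lambda>z. last_two j (e z)) W"
proof -
  define p where "p z = (v z j, v z (Suc j))" for z
  have contp: "continuous_on (cball 0 1) p"
    unfolding p_def using cont by (intro continuous_on_Pair) auto
  obtain e where e: "continuous_on (cball 0 1) e" "\<And>z. z \<in> cball 0 1 \<Longrightarrow> norm (e z) = 1"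
    "\<And>z. \<lbrakk>z \<in> cball 0 1; norm (p z) \<ge> 1 / 2\<rbrakk> \<Longrightarrow> e z = p z /\<^sub>R norm (p z)"
    by (rule disc_map_normalize_S3[OF contp]) (blast intro: that)
  note split = sum_atMost_split_last_two
  have norm_p: "(norm (p z))\<^sup>2 = (norm (v z j))\<^sup>2 + (norm (v z (Suc j)))\<^sup>2" for z
    by (simp add: p_def norm_Pair)
  \<comment> \<open>On the circle the first j coordinates vanish, so \<open>p z\<close> already has
    norm 1: it passes the threshold 1/2, and normalizing leaves it unchanged.\<close>
  have e_bdry: "e z = p z" if z: "norm z = 1" for z
  proof -
    have "(norm (p z))\<^sup>2 = 1"
      using unit[of z] z bdry[OF z] unfolding split norm_p by simp
    then have "norm (p z) = 1"
      by (simp add: power2_eq_1_iff) (metis norm_ge_zero not_one_le_zero neg_0_le_iff_le)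
    then show ?thesis
      using e(3)[of z] z by simp
  qed
  define x where "x p i = (1 - fst p) *\<^sub>R v (snd p) i + fst p *\<^sub>R last_two j (e (snd p)) i" for p i
  define N where "N p = sqrt (\<Sum>i\<le>Suc j. (norm (x p i))\<^sup>2)" for p
  define W where "W p i = x p i /\<^sub>R N p" for p i
  have contx: "continuous_on ({0..1} \<times> cball 0 1) (\<lambda>p. x p i)" if "i \<le> Suc j" for i
  proof -
    have "continuous_on ({0..1::real} \<times> cball 0 1) (\<lambda>p. v (snd p) i)"
      by (rule continuous_on_compose2[OF cont[OF that]]) (auto intro: continuous_intros)
    moreover have "continuous_on ({0..1::real} \<times> cball 0 1) (\<lambda>p. e (snd p))"
      by (rule continuous_on_compose2[OF e(1)]) (auto intro: continuous_intros)
    ultimately show ?thesis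
      unfolding x_def last_two_def by (cases "i = j"; cases "i = Suc j") (auto intro!: continuous_intros)
  qed
  have Npos: "N (s, z) > 0" if s: "s \<in> {0..1}" and z: "z \<in> cball 0 1" for s z
  proof (rule ccontr)
    assume "\<not> N (s, z) > 0"
    moreover have "N (s, z) \<ge> 0"
      unfolding N_def by (intro real_sqrt_ge_zero sum_nonneg) simp
    ultimately have "N (s, z) = 0"
      by simp
    then have "x (s, z) i = 0" if "i \<le> Suc j" for i
    proof -
      have "\<forall>i\<in>{..Suc j}. (norm (x (s, z) i))\<^sup>2 = 0"
        using \<open>N (s, z) = 0\<close> unfolding N_def real_sqrt_eq_zero_cancel_iff
        by (subst (asm) sum_nonneg_eq_0_iff) auto
      then show ?thesis
        using that by simp
    qed
    then have x0: "(1 - s) *\<^sub>R v z i + s *\<^sub>R last_two j (e z) i = 0" if "i \<le> Suc j" for i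
      using that by (simp add: x_def)
    have pair: "(1 - s) *\<^sub>R p z + s *\<^sub>R e z = 0"
      using x0[of j] x0[of "Suc j"] by (simp add: p_def last_two_def prod_eq_iff)
    show False
    proof (cases "norm (p z) \<ge> 1 / 2")
      \<comment> \<open>Here \<open>e z\<close> is a positive multiple of \<open>p z\<close>, so the
        combination of the two is a positive multiple of \<open>p z\<close> and cannot
        vanish.\<close>
      case True
      have "s *\<^sub>R e z = (s / norm (p z)) *\<^sub>R p z"
        unfolding e(3)[OF z True] by (simp add: divide_inverse)
      then have "((1 - s) + s / norm (p z)) *\<^sub>R p z = 0"
        using pair unfolding scaleR_add_left by (simp only:)
      moreover have "(1 - s) + s / norm (p z) > 0"
        using s True by (cases "s = 0") (auto intro!: add_nonneg_pos divide_pos_pos)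
      ultimately show False
        using True by auto
    next
      \<comment> \<open>At s = 1 the combination would be \<open>e z\<close>, of norm 1. For other s
        the first j coordinates of \<open>v z\<close> vanish, which forces \<open>p z\<close> to
        have norm 1, contrary to the case.\<close>
      case False
      have "s \<noteq> 1"
        using pair e(2)[OF z] by auto
      then have "v z i = 0" if "i < j" for i
        using x0[of i] that by (simp add: last_two_def)
      then have "(norm (p z))\<^sup>2 = 1"
        using unit[OF z] unfolding split norm_p by simp
      moreover have "(norm (p z))\<^sup>2 < 1"
        using False by (simp add: abs_square_less_1)
      ultimately show False
        by simp
    qed
  qed
  have N1: "N (s, z) = 1" if "(\<Sum>i\<le>Suc j. (norm (x (s, z) i))\<^sup>2) = 1" for s z
    unfolding N_def that by simp
  show thesis
  proof (rule that[OF e(1,2)])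
    show "e z = (v z j, v z (Suc j))" if "norm z = 1" for z
      using e_bdry[OF that] by (simp add: p_def)
    have xs: "x (s, z) i = v z i" if "norm z = 1" "i \<le> Suc j" for s z i
    proof -
      have "last_two j (e z) i = v z i"
        using e_bdry[OF that(1)] bdry[OF that(1), of i] that(2) by (auto simp: last_two_def p_def)
      then show ?thesis
        by (simp add: x_def flip: scaleR_add_left)
    qed
    show "disc_path (Suc j) v (\<lambda>z. last_two j (e z)) W"
      unfolding disc_path_def
    proof (intro conjI ballI allI impI)
      show "continuous_on ({0..1} \<times> cball 0 1) (\<lambda>p. W p i)" if "i \<le> Suc j" for i
      proof -
        have "continuous_on ({0..1} \<times> cball 0 1) N"
          unfolding N_def using contx by (intro continuous_intros) auto
        then show ?thesis
          unfolding W_def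
        proof (intro continuous_on_scaleR continuous_on_inverse contx[OF that] ballI)
          fix p :: "real \<times> complex"
          assume "p \<in> {0..1} \<times> cball 0 1"
          then have "N (fst p, snd p) > 0"
            by (intro Npos) (simp_all only: mem_Times_iff)
          then show "N p \<noteq> 0"
            by simp
        qed
      qed
      show "(\<Sum>i\<le>Suc j. (norm (W (s, z) i))\<^sup>2) = 1" if "s \<in> {0..1}" "z \<in> cball 0 1" for s z
      proof -
        have Nsq: "(\<Sum>i\<le>Suc j. (norm (x (s, z) i))\<^sup>2) = (N (s, z))\<^sup>2"
          unfolding N_def by (rule real_sqrt_pow2[symmetric]) (rule sum_nonneg, simp)
        have "(norm (W (s, z) i))\<^sup>2 = (norm (x (s, z) i))\<^sup>2 / (N (s, z))\<^sup>2" for i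
          using Npos[OF that] by (simp add: W_def field_simps power_mult_distrib)
        then have "(\<Sum>i\<le>Suc j. (norm (W (s, z) i))\<^sup>2) =
            (\<Sum>i\<le>Suc j. (norm (x (s, z) i))\<^sup>2) / (N (s, z))\<^sup>2"
          by (simp only: sum_divide_distrib)
        then show ?thesis
          unfolding Nsq using Npos[OF that] by simp
      qed
      fix z i
      assume i: "i \<le> Suc j"
      show "W (0, z) i = v z i" if "z \<in> cball 0 1"
        using N1[of 0 z] unit[OF that] by (simp add: W_def x_def del: sum.atMost_Suc atMost_Suc)
      show "W (1, z) i = last_two j (e z) i" if "z \<in> cball 0 1"
        using N1[of 1 z] sum_norm_last_two[of j "e z"] e(2)[OF that]
        by (simp add: W_def x_def del: sum.atMost_Suc atMost_Suc)
      show "W (s, z) i = v z i" if "z \<in> sphere 0 1" for s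
      proof -
        have "(\<Sum>i\<le>Suc j. (norm (x (s, z) i))\<^sup>2) = 1"
          using unit[of z] xs that by simp
        then show ?thesis
          using N1 xs[of z i] that i by (simp add: W_def)
      qed
    qed
  qed
qed

lemma disc_path_last_two:
  fixes e e' :: "complex \<Rightarrow> complex \<times> complex"
  assumes "continuous_on (cball 0 1) e" "continuous_on (cball 0 1) e'"
    and "\<And>z. z \<in> cball 0 1 \<Longrightarrow> norm (e z) = 1" "\<And>z. z \<in> cball 0 1 \<Longrightarrow> norm (e' z) = 1"
    and "\<And>z. norm z = 1 \<Longrightarrow> e z = e' z"
  obtains W where "disc_path (Suc j) (\<lambda>z. last_two j (e z)) (\<lambda>z. last_two j (e' z)) W"
proof (rule disc_homotopy_S3[OF assms])
  fix H :: "real \<times> complex \<Rightarrow> complex \<times> complex"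
  assume H: "continuous_on ({0..1} \<times> cball 0 1) H"
      "\<And>s z. \<lbrakk>s \<in> {0..1}; z \<in> cball 0 1\<rbrakk> \<Longrightarrow> norm (H (s, z)) = 1"
      "\<And>z. z \<in> cball 0 1 \<Longrightarrow> H (0, z) = e z" "\<And>z. z \<in> cball 0 1 \<Longrightarrow> H (1, z) = e' z"
      "\<And>s z. \<lbrakk>s \<in> {0..1}; norm z = 1\<rbrakk> \<Longrightarrow> H (s, z) = e z"
  have "continuous_on ({0..1} \<times> cball 0 1) (\<lambda>p. last_two j (H p) i)" for i
    unfolding last_two_def using H(1)
    by (cases "i = j"; cases "i = Suc j") (simp_all add: continuous_on_fst continuous_on_snd)
  moreover have "(\<Sum>i\<le>Suc j. (norm (last_two j (H (s, z)) i))\<^sup>2) = 1"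
    if "s \<in> {0..1}" "z \<in> cball 0 1" for s z
    unfolding sum_norm_last_two using H(2)[OF that] by simp
  moreover have "last_two j (H (s, z)) i = last_two j (e z) i" if "s \<in> {0..1}" "z \<in> sphere 0 1" for s z i
    using H(5)[of s z] that by simp
  ultimately have "disc_path (Suc j) (\<lambda>z. last_two j (e z)) (\<lambda>z. last_two j (e' z)) (\<lambda>p. last_two j (H p))"
    unfolding disc_path_def using H(3,4) by simp
  then show thesis
    by (rule that)
qed

section \<open>The degree of the last column of a commutator\<close>

definition real_coords :: "nat \<Rightarrow> (nat \<Rightarrow> complex) \<Rightarrow> nat \<Rightarrow> real" where
  "real_coords k w = (\<lambda>i. if i \<le> 2 * k + 1 then (if even i then Re (w (i div 2)) else Im (w (i div 2))) else 0)"

lemma real_coords_cong: "(\<And>i. i \<le> k \<Longrightarrow> w i = w' i) \<Longrightarrow> real_coords k w = real_coords k w'"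
  unfolding real_coords_def by (intro ext) auto

lemma sum_real_coords: "(\<Sum>i\<le>2 * k + 1. (real_coords k w i)\<^sup>2) = (\<Sum>l\<le>k. (norm (w l))\<^sup>2)"
proof -
  have "(\<Sum>i\<le>2 * n + 1. f i) = (\<Sum>l\<le>n. f (2 * l) + f (2 * l + 1))" for f :: "nat \<Rightarrow> real" and n
    by (induction n) simp_all
  then have "(\<Sum>i\<le>2 * k + 1. (real_coords k w i)\<^sup>2) =
      (\<Sum>l\<le>k. (real_coords k w (2 * l))\<^sup>2 + (real_coords k w (2 * l + 1))\<^sup>2)"
    by simp
  also have "\<dots> = (\<Sum>l\<le>k. (norm (w l))\<^sup>2)"
    by (rule sum.cong) (simp_all add: real_coords_def cmod_power2)
  finally show ?thesis .
qed

lemma real_coords_in_nsphere: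
  "real_coords k w \<in> topspace (nsphere (2 * k + 1)) \<longleftrightarrow> (\<Sum>l\<le>k. (norm (w l))\<^sup>2) = 1"
  unfolding topspace_nsphere_iff sum_real_coords by (simp add: real_coords_def)

lemma continuous_map_real_coords:
  assumes "\<And>l. l \<le> k \<Longrightarrow> continuous_map X euclidean (\<lambda>x. w x l)"
    and "\<And>x. x \<in> topspace X \<Longrightarrow> (\<Sum>l\<le>k. (norm (w x l))\<^sup>2) = 1"
  shows "continuous_map X (nsphere (2 * k + 1)) (\<lambda>x. real_coords k (w x))"
proof (rule continuous_map_into_nsphere)
  fix i
  assume i: "i \<le> 2 * k + 1"
  then have w: "continuous_map X euclidean (\<lambda>x. w x (i div 2))"
    by (intro assms) auto
  have "continuous_map X euclideanreal (\<lambda>x. Re (w x (i div 2)))"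
    by (rule continuous_map_comp_on[OF w, of UNIV]) (auto intro: continuous_intros)
  moreover have "continuous_map X euclideanreal (\<lambda>x. Im (w x (i div 2)))"
    by (rule continuous_map_comp_on[OF w, of UNIV]) (auto intro: continuous_intros)
  ultimately show "continuous_map X euclideanreal (\<lambda>x. real_coords k (w x) i)"
    using i by (simp add: real_coords_def)
qed (use assms(2) in \<open>simp add: real_coords_in_nsphere[simplified]\<close>)

lemma continuous_map_complex_mult:
  fixes f g :: "'a \<Rightarrow> complex"
  assumes "continuous_map X euclidean f" "continuous_map X euclidean g"
  shows "continuous_map X euclidean (\<lambda>x. f x * g x)"
proof -
  have "continuous_map X euclidean (\<lambda>x. (\<lambda>(a, b). a * b) (f x, g x))"
    by (rule continuous_map_comp_on[OF continuous_map_Pair_euclidean[OF assms], of UNIV])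
      (auto simp: split_def intro!: continuous_intros)
  then show ?thesis
    by simp
qed

section \<open>Isometries and block matrices, as functions of two indices\<close>

definition mat_apply :: "nat \<Rightarrow> (nat \<Rightarrow> nat \<Rightarrow> complex) \<Rightarrow> (nat \<Rightarrow> complex) \<Rightarrow> nat \<Rightarrow> complex" where
  "mat_apply k A w i = (\<Sum>l\<le>k. A i l * w l)"

text \<open>Unitarity in the form that the homotopies use: unit vectors stay on the sphere.\<close>

definition isometric_mat :: "nat \<Rightarrow> (nat \<Rightarrow> nat \<Rightarrow> complex) \<Rightarrow> bool" where
  "isometric_mat k A \<longleftrightarrow> (\<forall>w. (\<Sum>i\<le>k. (norm (mat_apply k A w i))\<^sup>2) = (\<Sum>i\<le>k. (norm (w i))\<^sup>2))"

definition block_mat :: "nat \<Rightarrow> (nat \<Rightarrow> nat \<Rightarrow> complex) \<Rightarrow> nat \<Rightarrow> nat \<Rightarrow> complex" where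
  "block_mat j A i l = (if i \<le> j \<and> l \<le> j then A i l else if i = l then 1 else 0)"

lemma mat_apply_cong:
  "(\<And>l. l \<le> k \<Longrightarrow> A i l * w l = A' i l * w' l) \<Longrightarrow> mat_apply k A w i = mat_apply k A' w' i"
  by (simp add: mat_apply_def)

lemma mat_apply_block_le: "i \<le> j \<Longrightarrow> mat_apply (Suc j) (block_mat j A) w i = mat_apply j A w i"
  unfolding mat_apply_def block_mat_def by simp

lemma mat_apply_block_Suc: "mat_apply (Suc j) (block_mat j A) w (Suc j) = w (Suc j)"
  unfolding mat_apply_def block_mat_def by simp

lemma isometric_block_mat:
  assumes "isometric_mat j A"
  shows "isometric_mat (Suc j) (block_mat j A)"
  unfolding isometric_mat_def
proof
  fix w
  have "(\<Sum>i\<le>j. (norm (mat_apply (Suc j) (block_mat j A) w i))\<^sup>2) = (\<Sum>i\<le>j. (norm (mat_apply j A w i))\<^sup>2)"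
    by (simp add: mat_apply_block_le)
  then show "(\<Sum>i\<le>Suc j. (norm (mat_apply (Suc j) (block_mat j A) w i))\<^sup>2) = (\<Sum>i\<le>Suc j. (norm (w i))\<^sup>2)"
    using assms by (simp add: mat_apply_block_Suc isometric_mat_def)
qed

text \<open>\<open>F\<close> comes from choosing a preimage. Nothing is said about continuity,
  because \<open>join_map_homotopic\<close> asks only for the values of its two end maps and yields
  their continuity.\<close>

lemma join_map_factor:
  fixes h :: "complex \<Rightarrow> (nat \<Rightarrow> real) \<Rightarrow> 'a"
  assumes "\<And>z u u'. \<lbrakk>norm z = 1; u \<in> topspace (nsphere m); u' \<in> topspace (nsphere m)\<rbrakk> \<Longrightarrow> h z u = h z u'"
  shows "\<exists>F. \<forall>z\<in>cball 0 1. \<forall>u\<in>topspace (nsphere m). F (join_map m z u) = h z u"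
proof -
  let ?P = "\<lambda>y p. fst p \<in> cball 0 1 \<and> snd p \<in> topspace (nsphere m) \<and> join_map m (fst p) (snd p) = y"
  define F where "F y = (let p = SOME p. ?P y p in h (fst p) (snd p))" for y
  show ?thesis
  proof (intro exI ballI)
    fix z :: complex and u :: "nat \<Rightarrow> real"
    assume zu: "z \<in> cball 0 1" "u \<in> topspace (nsphere m)"
    define p where "p = (SOME p. ?P (join_map m z u) p)"
    have "?P (join_map m z u) p"
      unfolding p_def by (rule someI[of _ "(z, u)"]) (use zu in simp)
    then have "z = fst p" "norm z = 1 \<or> u = snd p" "snd p \<in> topspace (nsphere m)"
      using join_map_eqD[OF zu(2) _ zu(1), of "snd p" "fst p"] by metis+
    then have "h (fst p) (snd p) = h z u"
      using assms[of z u "snd p"] zu by metis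
    then show "F (join_map m z u) = h z u"
      by (simp add: F_def p_def)
  qed
qed

section \<open>Homotopies parametrized by [0,1] x D^2 x S^m\<close>

abbreviation cylinder :: "nat \<Rightarrow> (real \<times> complex \<times> (nat \<Rightarrow> real)) topology" where
  "cylinder m \<equiv> prod_topology (top_of_set {0..1}) (disc_sphere m)"

lemma continuous_map_cylinder_base:
  assumes "continuous_on ({0..1} \<times> cball 0 1) h"
  shows "continuous_map (cylinder m) euclidean (\<lambda>p. h (fst p, fst (snd p)))"
proof (rule continuous_map_comp_on[OF continuous_map_Pair_euclidean _ assms])
  have "continuous_map (cylinder m) (top_of_set {0..1}) fst"
    by (rule continuous_map_fst)
  then show "continuous_map (cylinder m) euclidean fst"
    by (rule continuous_map_into_fulltopology)
  have "continuous_map (cylinder m) (top_of_set (cball 0 1)) (fst \<circ> snd)"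
    by (rule continuous_map_compose[OF continuous_map_snd continuous_map_fst])
  then show "continuous_map (cylinder m) euclidean (\<lambda>p. fst (snd p))"
    unfolding o_def by (rule continuous_map_into_fulltopology)
qed auto

lemma continuous_map_cylinder_sphere:
  assumes "continuous_map (nsphere m) Y h"
  shows "continuous_map (cylinder m) Y (\<lambda>p. h (snd (snd p)))"
proof -
  have "continuous_map (cylinder m) Y (h \<circ> (snd \<circ> snd))"
    by (rule continuous_map_compose[OF continuous_map_compose[OF continuous_map_snd continuous_map_snd] assms])
  then show ?thesis
    by (simp add: o_def)
qed

text \<open>\<open>join_map_homotopic\<close> for families of unit vectors in C^{j+2}. The
  dimensions match because 2j + 1 + 2 = 2(j + 1) + 1.\<close>

lemma Brouwer_degree2_cylinder_eq:
  assumes cont: "\<And>i. i \<le> Suc j \<Longrightarrow>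
      continuous_map (cylinder (2 * j + 1)) euclidean (\<lambda>p. W (fst p) (fst (snd p)) (snd (snd p)) i)"
    and unit: "\<And>s z u. \<lbrakk>s \<in> {0..1}; z \<in> cball 0 1; u \<in> topspace (nsphere (2 * j + 1))\<rbrakk>
        \<Longrightarrow> (\<Sum>i\<le>Suc j. (norm (W s z u i))\<^sup>2) = 1"
    and const: "\<And>s z u u' i. \<lbrakk>s \<in> {0..1}; norm z = 1; u \<in> topspace (nsphere (2 * j + 1));
        u' \<in> topspace (nsphere (2 * j + 1)); i \<le> Suc j\<rbrakk> \<Longrightarrow> W s z u i = W s z u' i"
    and F: "\<And>z u. \<lbrakk>z \<in> cball 0 1; u \<in> topspace (nsphere (2 * j + 1))\<rbrakk>
        \<Longrightarrow> F (join_map (2 * j + 1) z u) = real_coords (Suc j) (W 0 z u)"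
    and G: "\<And>z u. \<lbrakk>z \<in> cball 0 1; u \<in> topspace (nsphere (2 * j + 1))\<rbrakk>
        \<Longrightarrow> G (join_map (2 * j + 1) z u) = real_coords (Suc j) (W 1 z u)"
  shows "Brouwer_degree2 (2 * j + 1 + 2) F = Brouwer_degree2 (2 * j + 1 + 2) G"
proof (rule Brouwer_degree2_homotopic, rule join_map_homotopic)
  have "continuous_map (cylinder (2 * j + 1)) (nsphere (2 * Suc j + 1))
      (\<lambda>p. real_coords (Suc j) (W (fst p) (fst (snd p)) (snd (snd p))))"
    by (rule continuous_map_real_coords[OF cont], assumption) (rule unit, simp_all only: topspace_prod_topology
        topspace_euclidean_subtopology mem_Times_iff)
  then show "continuous_map (cylinder (2 * j + 1)) (nsphere (2 * j + 1 + 2))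
      (\<lambda>(s, z, u). real_coords (Suc j) (W s z u))"
    by (simp add: split_def)
  show "real_coords (Suc j) (W s z u) = real_coords (Suc j) (W s z u')"
    if "s \<in> {0..1}" "norm z = 1" "u \<in> topspace (nsphere (2 * j + 1))" "u' \<in> topspace (nsphere (2 * j + 1))"
    for s z u u'
    using const[OF that] by (rule real_coords_cong)
qed (use F G in auto)

text \<open>Only the vector moves, the block matrix stays. On the circle the vector is a multiple of
  the last basis vector all along the path; block matrices fix it, so the family does not depend on
  u there.\<close>

lemma Brouwer_degree2_disc_path:
  assumes W: "disc_path (Suc j) v w W" and bdry: "\<And>z i. \<lbrakk>norm z = 1; i \<le> j\<rbrakk> \<Longrightarrow> v z i = 0"
    and bcont: "\<And>i l. \<lbrakk>i \<le> j; l \<le> j\<rbrakk> \<Longrightarrow> continuous_map (nsphere (2 * j + 1)) euclidean (\<lambda>u. b u i l)"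
    and biso: "\<And>u. u \<in> topspace (nsphere (2 * j + 1)) \<Longrightarrow> isometric_mat j (b u)"
    and F: "\<And>z u. \<lbrakk>z \<in> cball 0 1; u \<in> topspace (nsphere (2 * j + 1))\<rbrakk>
        \<Longrightarrow> F (join_map (2 * j + 1) z u) = real_coords (Suc j) (mat_apply (Suc j) (block_mat j (b u)) (v z))"
    and G: "\<And>z u. \<lbrakk>z \<in> cball 0 1; u \<in> topspace (nsphere (2 * j + 1))\<rbrakk>
        \<Longrightarrow> G (join_map (2 * j + 1) z u) = real_coords (Suc j) (mat_apply (Suc j) (block_mat j (b u)) (w z))"
  shows "Brouwer_degree2 (2 * j + 1 + 2) F = Brouwer_degree2 (2 * j + 1 + 2) G"
proof (rule Brouwer_degree2_cylinder_eq[of j "\<lambda>s z u. mat_apply (Suc j) (block_mat j (b u)) (W (s, z))"])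
  have Wc: "continuous_map (cylinder (2 * j + 1)) euclidean (\<lambda>p. W (fst p, fst (snd p)) l)" if "l \<le> Suc j" for l
    using W that by (intro continuous_map_cylinder_base) (simp add: disc_path_def)
  have bc: "continuous_map (cylinder (2 * j + 1)) euclidean (\<lambda>p. block_mat j (b (snd (snd p))) i l)" for i l
    unfolding block_mat_def using continuous_map_cylinder_sphere[OF bcont[of i l]] by simp
  show "continuous_map (cylinder (2 * j + 1)) euclidean
      (\<lambda>p. mat_apply (Suc j) (block_mat j (b (snd (snd p)))) (W (fst p, fst (snd p))) i)" for i
    unfolding mat_apply_def by (intro continuous_map_sum continuous_map_complex_mult bc Wc) auto
  show "(\<Sum>i\<le>Suc j. (norm (mat_apply (Suc j) (block_mat j (b u)) (W (s, z)) i))\<^sup>2) = 1"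
    if "s \<in> {0..1}" "z \<in> cball 0 1" "u \<in> topspace (nsphere (2 * j + 1))" for s z u
    using isometric_block_mat[OF biso[OF that(3)]] W that(1,2)
    unfolding isometric_mat_def disc_path_def by (simp del: sum.atMost_Suc atMost_Suc)
  show "mat_apply (Suc j) (block_mat j (b u)) (W (s, z)) i = mat_apply (Suc j) (block_mat j (b u')) (W (s, z)) i"
    if "s \<in> {0..1}" "norm z = 1" for s z u u' i
  proof (rule mat_apply_cong)
    fix l
    assume "l \<le> Suc j"
    then have "W (s, z) l = v z l"
      using W that by (simp add: disc_path_def)
    then show "block_mat j (b u) i l * W (s, z) l = block_mat j (b u') i l * W (s, z) l"
      using bdry[OF that(2), of l] by (simp add: block_mat_def)
  qed
next
  fix z :: complex and u
  assume zu: "z \<in> cball 0 1" "u \<in> topspace (nsphere (2 * j + 1))"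
  have "W (0, z) l = v z l" "W (1, z) l = w z l" if "l \<le> Suc j" for l
    using W zu(1) that by (simp_all add: disc_path_def)
  then show "F (join_map (2 * j + 1) z u) = real_coords (Suc j) (mat_apply (Suc j) (block_mat j (b u)) (W (0, z)))"
    "G (join_map (2 * j + 1) z u) = real_coords (Suc j) (mat_apply (Suc j) (block_mat j (b u)) (W (1, z)))"
    unfolding F[OF zu] G[OF zu] by (auto intro!: real_coords_cong mat_apply_cong)
qed

text \<open>\<open>F\<close> is the last column of \<open>\<langle>g z, B u\<rangle>\<close> for a block matrix \<open>B u = diag (b u, 1)\<close>, with
  \<open>v z\<close> the last column of \<open>(g z)\<^sup>-\<^sup>1\<close>. The factor \<open>g z\<close> is removed by contracting the disc to \<open>1\<close>, and
  \<open>v\<close> is deformed to the standard disc in the last two coordinates with the same boundary values.\<close>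

theorem Brouwer_degree2_commutator_column:
  fixes g :: "complex \<Rightarrow> nat \<Rightarrow> nat \<Rightarrow> complex" and v :: "complex \<Rightarrow> nat \<Rightarrow> complex"
    and b :: "(nat \<Rightarrow> real) \<Rightarrow> nat \<Rightarrow> nat \<Rightarrow> complex"
  assumes gcont: "\<And>i l. \<lbrakk>i \<le> Suc j; l \<le> Suc j\<rbrakk> \<Longrightarrow> continuous_on (cball 0 1) (\<lambda>z. g z i l)"
    and giso: "\<And>z. z \<in> cball 0 1 \<Longrightarrow> isometric_mat (Suc j) (g z)"
    and g1: "\<And>i l. \<lbrakk>i \<le> Suc j; l \<le> Suc j\<rbrakk> \<Longrightarrow> g 1 i l = (if i = l then 1 else 0)"
    and vcont: "\<And>i. i \<le> Suc j \<Longrightarrow> continuous_on (cball 0 1) (\<lambda>z. v z i)"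
    and vunit: "\<And>z. z \<in> cball 0 1 \<Longrightarrow> (\<Sum>i\<le>Suc j. (norm (v z i))\<^sup>2) = 1"
    and vbdry: "\<And>z i. \<lbrakk>norm z = 1; i \<le> Suc j\<rbrakk> \<Longrightarrow> v z i = (if i = Suc j then z ^ Suc j else 0)"
    and bcont: "\<And>i l. \<lbrakk>i \<le> j; l \<le> j\<rbrakk> \<Longrightarrow> continuous_map (nsphere (2 * j + 1)) euclidean (\<lambda>u. b u i l)"
    and biso: "\<And>u. u \<in> topspace (nsphere (2 * j + 1)) \<Longrightarrow> isometric_mat j (b u)"
    and F: "\<And>z u. \<lbrakk>z \<in> cball 0 1; u \<in> topspace (nsphere (2 * j + 1))\<rbrakk> \<Longrightarrow> F (join_map (2 * j + 1) z u) =
        real_coords (Suc j) (mat_apply (Suc j) (g z) (mat_apply (Suc j) (block_mat j (b u)) (v z)))"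
  shows "Brouwer_degree2 (2 * j + 1 + 2) F =
    int (Suc j) * Brouwer_degree2 (2 * j + 1) (\<lambda>u. real_coords j (\<lambda>i. b u i j))"
proof -
  let ?m = "2 * j + 1"
  let ?S = "topspace (nsphere ?m)"
  define B where "B u = mat_apply (Suc j) (block_mat j (b u))" for u
  have Bunit: "(\<Sum>i\<le>Suc j. (norm (B u w i))\<^sup>2) = (\<Sum>i\<le>Suc j. (norm (w i))\<^sup>2)" if "u \<in> ?S" for u w
    using isometric_block_mat[OF biso[OF that]] unfolding isometric_mat_def B_def by blast
  have Bbdry: "B u w = B u' w" if "\<And>i. i \<le> j \<Longrightarrow> w i = 0" for u u' w
  proof
    show "B u w i = B u' w i" for i
      unfolding B_def using that by (intro mat_apply_cong) (auto simp: block_mat_def)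
  qed
  have vb0: "v z i = 0" if "norm z = 1" "i \<le> j" for z i
    using vbdry[OF that(1), of i] that(2) by simp

  obtain e W1 where e: "continuous_on (cball 0 1) e" "\<And>z. z \<in> cball 0 1 \<Longrightarrow> norm (e z) = 1"
    "\<And>z. norm z = 1 \<Longrightarrow> e z = (v z j, v z (Suc j))"
    and W1: "disc_path (Suc j) v (\<lambda>z. last_two j (e z)) W1"
    by (rule disc_path_into_last_two[OF vcont vunit]) (use vb0 that in auto)
  \<comment> \<open>Chosen to have the boundary values of \<open>e\<close>, and so that a block
    matrix turns it into a join: the root is the factor of u in \<open>join_map\<close>, and
    \<open>sgn_power\<close> is left alone by the corner 1.\<close>
  define e' where "e' z = (complex_of_real (sqrt (1 - (norm z)\<^sup>2)), sgn_power (Suc j) z)" for z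
  have e'cont: "continuous_on (cball 0 1) e'"
    unfolding e'_def by (intro continuous_intros continuous_on_sgn_power)
  have e'norm: "norm (e' z) = 1" if "z \<in> cball 0 1" for z
  proof -
    have "(norm z)\<^sup>2 \<le> 1"
      using that by (simp add: abs_square_le_1)
    then show ?thesis
      by (simp add: e'_def norm_Pair)
  qed
  have ee': "e z = e' z" if "norm z = 1" for z
    using e(3)[OF that] vbdry[OF that] that by (simp add: e'_def sgn_power_unit)
  obtain W2 where W2: "disc_path (Suc j) (\<lambda>z. last_two j (e z)) (\<lambda>z. last_two j (e' z)) W2"
    using disc_path_last_two[OF e(1) e'cont e(2) e'norm ee'] by blast
  have ebdry: "last_two j (e z) i = 0" if "norm z = 1" "i \<le> j" for z i
    using e(3)[OF that(1)] vb0[OF that(1)] that(2) by (auto simp: last_two_def)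
  have e'bdry: "last_two j (e' z) i = 0" if "norm z = 1" "i \<le> j" for z i
    using that by (auto simp: last_two_def e'_def)

  \<comment> \<open>\<open>F0\<close>, \<open>F1\<close>, \<open>F2\<close> are the maps between the
    deformations: after removing \<open>g\<close>, after moving \<open>v\<close> into the last two
    coordinates, and after reaching the standard disc.\<close>
  have "\<exists>F. \<forall>z\<in>cball 0 1. \<forall>u\<in>?S. F (join_map ?m z u) = real_coords (Suc j) (B u (v z))"
    by (rule join_map_factor) (rule arg_cong[OF Bbdry[OF vb0]])
  then obtain F0 where F0: "\<And>z u. \<lbrakk>z \<in> cball 0 1; u \<in> ?S\<rbrakk>
      \<Longrightarrow> F0 (join_map ?m z u) = real_coords (Suc j) (B u (v z))"
    by blast
  have "\<exists>F. \<forall>z\<in>cball 0 1. \<forall>u\<in>?S. F (join_map ?m z u) = real_coords (Suc j) (B u (last_two j (e z)))"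
    by (rule join_map_factor) (rule arg_cong[OF Bbdry[OF ebdry]])
  then obtain F1 where F1: "\<And>z u. \<lbrakk>z \<in> cball 0 1; u \<in> ?S\<rbrakk>
      \<Longrightarrow> F1 (join_map ?m z u) = real_coords (Suc j) (B u (last_two j (e z)))"
    by blast
  have "\<exists>F. \<forall>z\<in>cball 0 1. \<forall>u\<in>?S. F (join_map ?m z u) = real_coords (Suc j) (B u (last_two j (e' z)))"
    by (rule join_map_factor) (rule arg_cong[OF Bbdry[OF e'bdry]])
  then obtain F2 where F2: "\<And>z u. \<lbrakk>z \<in> cball 0 1; u \<in> ?S\<rbrakk>
      \<Longrightarrow> F2 (join_map ?m z u) = real_coords (Suc j) (B u (last_two j (e' z)))"
    by blast

  \<comment> \<open>The argument of \<open>g\<close> runs along the segment from z to 1, where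
    \<open>g\<close> is the identity. It leaves the circle even for z on the circle, but there
    \<open>B u (v z)\<close> is already independent of u, so the family still descends.\<close>
  have "Brouwer_degree2 (?m + 2) F = Brouwer_degree2 (?m + 2) F0"
  proof (rule Brouwer_degree2_cylinder_eq[of j
        "\<lambda>s z u. mat_apply (Suc j) (g ((1 - s) *\<^sub>R z + s *\<^sub>R 1)) (B u (v z))"])
    have disc: "(1 - s) *\<^sub>R z + s *\<^sub>R 1 \<in> cball 0 1" if "s \<in> {0..1}" "z \<in> cball 0 1" for s and z :: complex
      using that by (intro convexD[OF convex_cball]) auto
    have gc: "continuous_map (cylinder ?m) euclidean (\<lambda>p. g ((1 - fst p) *\<^sub>R fst (snd p) + fst p *\<^sub>R 1) i l)"
      if "i \<le> Suc j" "l \<le> Suc j" for i l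
    proof -
      have "continuous_on ({0..1} \<times> cball 0 1) (\<lambda>q. g ((1 - fst q) *\<^sub>R snd q + fst q *\<^sub>R 1) i l)"
        by (rule continuous_on_compose2[OF gcont[OF that]]) (use disc in \<open>auto intro!: continuous_intros simp del: mem_cball\<close>)
      from continuous_map_cylinder_base[OF this] show ?thesis
        by simp
    qed
    have vc: "continuous_map (cylinder ?m) euclidean (\<lambda>p. v (fst (snd p)) l)" if "l \<le> Suc j" for l
    proof -
      have "continuous_on ({0..1::real} \<times> cball 0 1) (\<lambda>q. v (snd q) l)"
        by (rule continuous_on_compose2[OF vcont[OF that] continuous_on_snd[OF continuous_on_id]]) auto
      from continuous_map_cylinder_base[OF this] show ?thesis
        by simp
    qed
    have bc: "continuous_map (cylinder ?m) euclidean (\<lambda>p. block_mat j (b (snd (snd p))) i l)" for i l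
      unfolding block_mat_def using continuous_map_cylinder_sphere[OF bcont[of i l]] by simp
    have Bc: "continuous_map (cylinder ?m) euclidean (\<lambda>p. B (snd (snd p)) (v (fst (snd p))) i)" for i
      unfolding B_def mat_apply_def by (intro continuous_map_sum continuous_map_complex_mult bc vc) auto
    show "continuous_map (cylinder ?m) euclidean
        (\<lambda>p. mat_apply (Suc j) (g ((1 - fst p) *\<^sub>R fst (snd p) + fst p *\<^sub>R 1)) (B (snd (snd p)) (v (fst (snd p)))) i)"
      if "i \<le> Suc j" for i
      unfolding mat_apply_def[of _ "g _"] using that
      by (intro continuous_map_sum continuous_map_complex_mult gc Bc) auto
    show "(\<Sum>i\<le>Suc j. (norm (mat_apply (Suc j) (g ((1 - s) *\<^sub>R z + s *\<^sub>R 1)) (B u (v z)) i))\<^sup>2) = 1"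
      if "s \<in> {0..1}" "z \<in> cball 0 1" "u \<in> ?S" for s z u
      using giso[OF disc[OF that(1,2)]] Bunit[OF that(3)] vunit[OF that(2)]
      unfolding isometric_mat_def by (simp del: sum.atMost_Suc atMost_Suc)
    show "mat_apply (Suc j) (g ((1 - s) *\<^sub>R z + s *\<^sub>R 1)) (B u (v z)) i =
        mat_apply (Suc j) (g ((1 - s) *\<^sub>R z + s *\<^sub>R 1)) (B u' (v z)) i" if "norm z = 1" for s z u u' i
      by (rule arg_cong[OF Bbdry[OF vb0[OF that]], where f = "\<lambda>w. mat_apply _ _ w _"])
    show "F (join_map ?m z u) = real_coords (Suc j) (mat_apply (Suc j) (g ((1 - 0) *\<^sub>R z + 0 *\<^sub>R 1)) (B u (v z)))"
      if "z \<in> cball 0 1" "u \<in> ?S" for z u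
      using F[OF that] by (simp add: B_def)
    show "F0 (join_map ?m z u) = real_coords (Suc j) (mat_apply (Suc j) (g ((1 - 1) *\<^sub>R z + 1 *\<^sub>R 1)) (B u (v z)))"
      if "z \<in> cball 0 1" "u \<in> ?S" for z u
    proof -
      have "mat_apply (Suc j) (g 1) w i = w i" if "i \<le> Suc j" for w i
      proof -
        have "mat_apply (Suc j) (g 1) w i = (\<Sum>l\<le>Suc j. if i = l then w l else 0)"
          unfolding mat_apply_def using g1[OF that] by (intro sum.cong) auto
        then show ?thesis
          using that by (simp del: sum.atMost_Suc atMost_Suc)
      qed
      then show ?thesis
        unfolding F0[OF that] by (intro real_coords_cong) simp
    qed
  qed
  also have "\<dots> = Brouwer_degree2 (?m + 2) F1"
    by (rule Brouwer_degree2_disc_path[OF W1 vb0 bcont biso F0[unfolded B_def] F1[unfolded B_def]])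
  also have "\<dots> = Brouwer_degree2 (?m + 2) F2"
    by (rule Brouwer_degree2_disc_path[OF W2 ebdry bcont biso F1[unfolded B_def] F2[unfolded B_def]])
  also have "\<dots> = int (Suc j) * Brouwer_degree2 ?m (\<lambda>u. real_coords j (\<lambda>i. b u i j))"
  proof (rule Brouwer_degree2_join_power)
    show "continuous_map (nsphere ?m) (nsphere ?m) (\<lambda>u. real_coords j (\<lambda>i. b u i j))"
    proof (rule continuous_map_real_coords)
      show "(\<Sum>l\<le>j. (norm (b u l j))\<^sup>2) = 1" if "u \<in> ?S" for u
      proof -
        \<comment> \<open>The j-th basis vector: an isometry sends it to column j, which therefore
          has norm 1.\<close>
        define w where "w l = (if l = j then 1 else 0 :: complex)" for l
        have "(\<Sum>i\<le>j. (norm (mat_apply j (b u) w i))\<^sup>2) = (\<Sum>i\<le>j. (norm (w i))\<^sup>2)"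
          using biso[OF that] unfolding isometric_mat_def by blast
        moreover have "mat_apply j (b u) w i = b u i j" for i
          by (simp add: mat_apply_def w_def if_distrib cong: if_cong)
        moreover have "(\<Sum>l\<le>j. (norm (w l))\<^sup>2) = (\<Sum>l\<le>j. if l = j then 1 else 0)"
          by (rule sum.cong) (simp_all add: w_def)
        ultimately show ?thesis
          by simp
      qed
    qed (rule bcont, simp_all)
    fix z :: complex and u
    assume zu: "z \<in> cball 0 1" "u \<in> ?S"
    \<comment> \<open>Among the first j + 1 coordinates of the standard disc only number j survives,
      so the block contributes its last column, scaled by the root.\<close>
    have lo: "B u (last_two j (e' z)) i = sqrt (1 - (norm z)\<^sup>2) * b u i j" if "i \<le> j" for i
    proof -
      have "B u (last_two j (e' z)) i = (\<Sum>l\<le>j. if l = j then b u i j * sqrt (1 - (norm z)\<^sup>2) else 0)"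
        unfolding B_def mat_apply_block_le[OF that] unfolding mat_apply_def
        by (rule sum.cong) (simp_all add: last_two_def e'_def)
      then show ?thesis
        by simp
    qed
    have hi: "B u (last_two j (e' z)) (Suc j) = sgn_power (Suc j) z"
      unfolding B_def mat_apply_block_Suc by (simp add: last_two_def e'_def)
    have "real_coords (Suc j) (B u (last_two j (e' z))) i =
        join_map ?m (sgn_power (Suc j) z) (real_coords j (\<lambda>i. b u i j)) i" for i
    proof -
      consider "i \<le> ?m" | "i = Suc ?m" | "i = Suc (Suc ?m)" | "i > Suc (Suc ?m)"
        by linarith
      then show ?thesis
      proof cases
        case 1
        then have "i div 2 \<le> j"
          by simp
        from lo[OF this] 1 show ?thesis
          by (simp add: real_coords_def join_map_def)
      qed (simp_all add: real_coords_def join_map_def hi)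
    qed
    then show "F2 (join_map ?m z u) = join_map ?m (sgn_power (Suc j) z) (real_coords j (\<lambda>i. b u i j))"
      unfolding F2[OF zu] by blast
  qed simp
  finally show ?thesis .
qed

section \<open>Special unitary matrices\<close>

lemma SU_D:
  assumes "A \<in> carrier (SU n)"
  shows "A \<in> carrier_mat n n" "A * mat_adjoint A = 1\<^sub>m n" "mat_adjoint A * A = 1\<^sub>m n" "Determinant.det A = 1"
  using assms mat_mult_left_right_inverse[of A n "mat_adjoint A"] mat_adjoint_carrier[of A n]
  by (auto simp: SU_def)

lemma inv_SU:
  assumes A: "A \<in> carrier (SU n)"
  shows "inv\<^bsub>SU n\<^esub> A = mat_adjoint A"
proof -
  interpret group "SU n"
    by (rule group_SU)
  let ?B = "inv\<^bsub>SU n\<^esub> A"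
  have B: "?B \<in> carrier_mat n n"
    using A SU_D(1) by blast
  have "?B * A = 1\<^sub>m n"
    using l_inv[OF A] by (simp add: SU_def)
  then have "mat_adjoint A = (?B * A) * mat_adjoint A"
    using mat_adjoint_carrier[OF SU_D(1)[OF A]] by simp
  also have "\<dots> = ?B * (A * mat_adjoint A)"
    by (rule assoc_mult_mat[OF B SU_D(1)[OF A] mat_adjoint_carrier[OF SU_D(1)[OF A]]])
  also have "\<dots> = ?B"
    using SU_D(2)[OF A] B by simp
  finally show ?thesis ..
qed

lemma mat_adjoint_SU: "A \<in> carrier (SU n) \<Longrightarrow> mat_adjoint A \<in> carrier (SU n)"
  using group.inv_closed[OF group_SU] inv_SU by metis

lemma mult_SU: "\<lbrakk>A \<in> carrier (SU n); B \<in> carrier (SU n)\<rbrakk> \<Longrightarrow> A * B \<in> carrier (SU n)"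
  using monoid.m_closed[OF group.is_monoid[OF group_SU], of A n B] by (simp add: SU_def)

lemma one_SU [simp]: "\<one>\<^bsub>SU n\<^esub> = 1\<^sub>m n"
  by (simp add: SU_def)

lemma index_mult_mat_sum:
  assumes "A \<in> carrier_mat n n" "B \<in> carrier_mat n n" "i < n" "j < n"
  shows "(A * B) $$ (i, j) = (\<Sum>l<n. A $$ (i, l) * B $$ (l, j))"
  using assms by (simp add: scalar_prod_def lessThan_atLeast0)

lemma SU_columns_orthonormal:
  assumes A: "A \<in> carrier (SU n)" and "l < n" "l' < n"
  shows "(\<Sum>i<n. A $$ (i, l) * cnj (A $$ (i, l'))) = (if l = l' then 1 else 0)"
proof -
  have "(\<Sum>i<n. A $$ (i, l) * cnj (A $$ (i, l'))) = (mat_adjoint A * A) $$ (l', l)"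
    unfolding index_mult_mat_sum[OF mat_adjoint_carrier[OF SU_D(1)[OF A]] SU_D(1)[OF A] assms(3,2)]
    using assms(3) by (intro sum.cong) (simp_all add: index_mat_adjoint[OF SU_D(1)[OF A]])
  then show ?thesis
    using assms by (simp add: SU_D(3)[OF A])
qed

text \<open>The squared norm of the image is expanded into a triple sum over i, l, l'; summing over
  i first leaves only the diagonal terms.\<close>

lemma isometric_mat_orthonormal:
  assumes "\<And>l l'. \<lbrakk>l \<le> k; l' \<le> k\<rbrakk> \<Longrightarrow> (\<Sum>i\<le>k. A i l * cnj (A i l')) = (if l = l' then 1 else 0)"
  shows "isometric_mat k A"
  unfolding isometric_mat_def
proof
  fix w
  have "complex_of_real (\<Sum>i\<le>k. (norm (mat_apply k A w i))\<^sup>2) = (\<Sum>i\<le>k. mat_apply k A w i * cnj (mat_apply k A w i))"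
    by (simp only: of_real_sum complex_norm_square)
  also have "\<dots> = (\<Sum>i\<le>k. \<Sum>l\<le>k. \<Sum>l'\<le>k. (w l * cnj (w l')) * (A i l * cnj (A i l')))"
    by (simp add: mat_apply_def sum_product algebra_simps)
  also have "\<dots> = (\<Sum>l\<le>k. \<Sum>i\<le>k. \<Sum>l'\<le>k. (w l * cnj (w l')) * (A i l * cnj (A i l')))"
    by (rule sum.swap)
  also have "\<dots> = (\<Sum>l\<le>k. \<Sum>l'\<le>k. \<Sum>i\<le>k. (w l * cnj (w l')) * (A i l * cnj (A i l')))"
    by (rule sum.cong[OF refl], rule sum.swap)
  also have "\<dots> = (\<Sum>l\<le>k. \<Sum>l'\<le>k. (w l * cnj (w l')) * (if l = l' then 1 else 0))"
    using assms by (intro sum.cong refl) (simp flip: sum_distrib_left)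
  also have "\<dots> = (\<Sum>l\<le>k. w l * cnj (w l))"
    by (intro sum.cong refl) (simp add: if_distrib cong: if_cong)
  also have "\<dots> = complex_of_real (\<Sum>i\<le>k. (norm (w i))\<^sup>2)"
    by (simp only: of_real_sum complex_norm_square)
  finally show "(\<Sum>i\<le>k. (norm (mat_apply k A w i))\<^sup>2) = (\<Sum>i\<le>k. (norm (w i))\<^sup>2)"
    by (simp only: of_real_eq_iff)
qed

lemma isometric_SU: "A \<in> carrier (SU (k + 1)) \<Longrightarrow> isometric_mat k (\<lambda>i l. A $$ (i, l))"
  using SU_columns_orthonormal[of A "Suc k"]
  by (intro isometric_mat_orthonormal) (simp add: lessThan_Suc_atMost)

lemma continuous_map_SU_entry:
  assumes f: "continuous_map X (SU_space n) f" and "i < n" "j < n"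
  shows "continuous_map X euclidean (\<lambda>x. f x $$ (i, j))"
proof -
  let ?r = "\<lambda>A. restrict (\<lambda>p. A $$ p) ({..<n} \<times> {..<n})"
  have "continuous_map (product_topology (\<lambda>_. euclidean :: complex topology) ({..<n} \<times> {..<n})) euclidean (\<lambda>v. v (i, j))"
    by (rule continuous_map_product_projection) (use assms in simp)
  then have "continuous_map (SU_space n) euclidean ((\<lambda>v. v (i, j)) \<circ> ?r)"
    unfolding SU_space_def by (rule continuous_map_pullback)
  then have "continuous_map X euclidean (((\<lambda>v. v (i, j)) \<circ> ?r) \<circ> f)"
    using f continuous_map_compose by blast
  then show ?thesis
    using assms(2,3) by (simp add: o_def)
qed

lemma continuous_map_into_SU:
  assumes "\<And>i j. \<lbrakk>i < n; j < n\<rbrakk> \<Longrightarrow> continuous_map X euclidean (\<lambda>x. f x $$ (i, j))"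
    and "\<And>x. x \<in> topspace X \<Longrightarrow> f x \<in> carrier (SU n)"
  shows "continuous_map X (SU_space n) f"
  unfolding SU_space_def
proof (rule continuous_map_pullback')
  show "topspace X \<subseteq> f -` carrier (SU n)"
    using assms(2) by auto
  show "continuous_map X (product_topology (\<lambda>_. euclidean) ({..<n} \<times> {..<n}))
      ((\<lambda>A. restrict (\<lambda>p. A $$ p) ({..<n} \<times> {..<n})) \<circ> f)"
    unfolding continuous_map_componentwise using assms(1) by auto
qed

lemma continuous_map_SU_carrier:
  assumes "continuous_map X (SU_space n) f" "x \<in> topspace X"
  shows "f x \<in> carrier (SU n)"
  using continuous_map_image_subset_topspace[OF assms(1)] assms(2) unfolding topspace_SU_space by blast

lemma continuous_map_SU_mult:
  assumes f: "continuous_map X (SU_space n) f" and g: "continuous_map X (SU_space n) g"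
  shows "continuous_map X (SU_space n) (\<lambda>x. f x * g x)"
proof (rule continuous_map_into_SU)
  fix i j
  assume ij: "i < n" "j < n"
  have "continuous_map X euclidean (\<lambda>x. \<Sum>l<n. f x $$ (i, l) * g x $$ (l, j))"
    using ij by (intro continuous_map_sum continuous_map_complex_mult 
        continuous_map_SU_entry[OF f] continuous_map_SU_entry[OF g]) auto
  then show "continuous_map X euclidean (\<lambda>x. (f x * g x) $$ (i, j))"
  proof (rule continuous_map_eq)
    fix x
    assume x: "x \<in> topspace X"
    show "(\<Sum>l<n. f x $$ (i, l) * g x $$ (l, j)) = (f x * g x) $$ (i, j)"
      by (rule index_mult_mat_sum[OF SU_D(1)[OF continuous_map_SU_carrier[OF f x]]
            SU_D(1)[OF continuous_map_SU_carrier[OF g x]] ij, symmetric])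
  qed
qed (intro mult_SU continuous_map_SU_carrier[OF f] continuous_map_SU_carrier[OF g])

lemma continuous_map_SU_adjoint:
  assumes f: "continuous_map X (SU_space n) f"
  shows "continuous_map X (SU_space n) (\<lambda>x. mat_adjoint (f x))"
proof (rule continuous_map_into_SU)
  fix i j
  assume ij: "i < n" "j < n"
  have "continuous_map X euclidean (\<lambda>x. cnj (f x $$ (j, i)))"
    by (rule continuous_map_comp_on[OF continuous_map_SU_entry[OF f ij(2,1)], of UNIV])
      (auto intro!: continuous_intros)
  then show "continuous_map X euclidean (\<lambda>x. mat_adjoint (f x) $$ (i, j))"
  proof (rule continuous_map_eq)
    fix x
    assume "x \<in> topspace X"
    from SU_D(1)[OF continuous_map_SU_carrier[OF f this]]
    show "cnj (f x $$ (j, i)) = mat_adjoint (f x) $$ (i, j)"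
      using index_mat_adjoint ij by metis
  qed
qed (intro mat_adjoint_SU continuous_map_SU_carrier[OF f])

lemma group_commutator_SU:
  assumes "A \<in> carrier (SU n)" "B \<in> carrier (SU n)"
  shows "group_commutator (SU n) A B = A * B * mat_adjoint A * mat_adjoint B"
  unfolding group_commutator_def inv_SU[OF assms(1)] inv_SU[OF assms(2)] by (simp add: SU_def)

lemma SU_column_unit:
  assumes "A \<in> carrier (SU (k + 1))" "j \<le> k"
  shows "(\<Sum>l\<le>k. (norm (A $$ (l, j)))\<^sup>2) = 1"
proof -
  have "complex_of_real (\<Sum>l\<le>k. (norm (A $$ (l, j)))\<^sup>2) = (\<Sum>l\<le>k. A $$ (l, j) * cnj (A $$ (l, j)))"
    by (simp only: of_real_sum complex_norm_square)
  also have "\<dots> = complex_of_real 1"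
    using SU_columns_orthonormal[of A "Suc k" j j] assms by (simp add: lessThan_Suc_atMost del: sum.atMost_Suc)
  finally show ?thesis
    by (simp only: of_real_eq_iff)
qed

text \<open>The bundle projection of SU(k+1) onto S^{2k+1} with fibre SU(k), in real
  coordinates.\<close>

definition last_column :: "nat \<Rightarrow> complex mat \<Rightarrow> nat \<Rightarrow> real" where
  "last_column k A = real_coords k (\<lambda>i. A $$ (i, k))"

lemma continuous_map_last_column:
  "continuous_map (SU_space (k + 1)) (nsphere (2 * k + 1)) (last_column k)"
  unfolding last_column_def
proof (rule continuous_map_real_coords)
  show "continuous_map (SU_space (k + 1)) euclidean (\<lambda>A. A $$ (l, k))" if "l \<le> k" for l
    using continuous_map_SU_entry[OF continuous_map_id[of "SU_space (k + 1)"], of l k] that by simp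
  show "(\<Sum>l\<le>k. (norm (A $$ (l, k)))\<^sup>2) = 1" if "A \<in> topspace (SU_space (k + 1))" for A
    using that by (intro SU_column_unit) (simp_all add: topspace_SU_space)
qed

section \<open>The embedding of SU(n) into SU(n + 1)\<close>

lemma index_SU_embed:
  assumes "A \<in> carrier_mat n n" "i < n + 1" "j < n + 1"
  shows "SU_embed A $$ (i, j) = (if i < n \<and> j < n then A $$ (i, j) else if i = j then 1 else 0)"
  using assms by (auto simp: SU_embed_def)

lemma SU_embed_carrier_mat: "A \<in> carrier_mat n n \<Longrightarrow> SU_embed A \<in> carrier_mat (n + 1) (n + 1)"
  unfolding SU_embed_def by (metis carrier_matD four_block_carrier_mat one_carrier_mat)

lemma SU_embed_one: "SU_embed (1\<^sub>m n) = 1\<^sub>m (n + 1)"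
  unfolding SU_embed_def by (simp add: four_block_one_mat)

lemma SU_embed_mult:
  assumes A: "A \<in> carrier_mat n n" and B: "B \<in> carrier_mat n n"
  shows "SU_embed A * SU_embed B = SU_embed (A * B)"
proof -
  have "four_block_mat A (0\<^sub>m n 1) (0\<^sub>m 1 n) (1\<^sub>m 1) * four_block_mat B (0\<^sub>m n 1) (0\<^sub>m 1 n) (1\<^sub>m 1) =
      four_block_mat (A * B + 0\<^sub>m n 1 * 0\<^sub>m 1 n) (A * 0\<^sub>m n 1 + 0\<^sub>m n 1 * 1\<^sub>m 1)
        (0\<^sub>m 1 n * B + 1\<^sub>m 1 * 0\<^sub>m 1 n) (0\<^sub>m 1 n * 0\<^sub>m n 1 + 1\<^sub>m 1 * 1\<^sub>m 1)"
    by (rule mult_four_block_mat[OF A zero_carrier_mat zero_carrier_mat one_carrier_mat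
          B zero_carrier_mat zero_carrier_mat one_carrier_mat])
  then show ?thesis
    using A B unfolding SU_embed_def by simp
qed

lemma mat_adjoint_SU_embed:
  assumes A: "A \<in> carrier_mat n n"
  shows "mat_adjoint (SU_embed A) = SU_embed (mat_adjoint A)"
proof (rule eq_matI)
  note c = mat_adjoint_carrier[OF SU_embed_carrier_mat[OF A]] SU_embed_carrier_mat[OF mat_adjoint_carrier[OF A]]
  show "dim_row (mat_adjoint (SU_embed A)) = dim_row (SU_embed (mat_adjoint A))"
    "dim_col (mat_adjoint (SU_embed A)) = dim_col (SU_embed (mat_adjoint A))"
    using c by auto
  fix i j
  assume "i < dim_row (SU_embed (mat_adjoint A))" "j < dim_col (SU_embed (mat_adjoint A))"
  then have ij: "i < n + 1" "j < n + 1"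
    using c by auto
  show "mat_adjoint (SU_embed A) $$ (i, j) = SU_embed (mat_adjoint A) $$ (i, j)"
    unfolding index_mat_adjoint[OF SU_embed_carrier_mat[OF A] ij] index_SU_embed[OF A ij(2,1)]
      index_SU_embed[OF mat_adjoint_carrier[OF A] ij]
    by (auto simp: index_mat_adjoint[OF A])
qed

lemma SU_embed_SU:
  assumes A: "A \<in> carrier (SU n)"
  shows "SU_embed A \<in> carrier (SU (n + 1))"
proof -
  note c = SU_D(1)[OF A]
  have "Determinant.det (SU_embed A) = Determinant.det A * Determinant.det (1\<^sub>m 1 :: complex mat)"
    unfolding SU_embed_def by (rule det_four_block_mat_upper_right_zero[of _ n _ 1]) (use c in simp_all)
  moreover have "SU_embed A * mat_adjoint (SU_embed A) = 1\<^sub>m (n + 1)"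
    unfolding mat_adjoint_SU_embed[OF c] SU_embed_mult[OF c mat_adjoint_carrier[OF c]]
      SU_D(2)[OF A] SU_embed_one ..
  ultimately show ?thesis
    using SU_embed_carrier_mat[OF c] SU_D(4)[OF A] by (simp add: SU_def)
qed

lemma continuous_map_SU_embed:
  assumes f: "continuous_map X (SU_space n) f"
  shows "continuous_map X (SU_space (n + 1)) (\<lambda>x. SU_embed (f x))"
proof (rule continuous_map_into_SU)
  fix i j
  assume ij: "i < n + 1" "j < n + 1"
  have "continuous_map X euclidean (\<lambda>x. if i < n \<and> j < n then f x $$ (i, j) else if i = j then 1 else 0)"
    using continuous_map_SU_entry[OF f, of i j] by simp
  then show "continuous_map X euclidean (\<lambda>x. SU_embed (f x) $$ (i, j))"
  proof (rule continuous_map_eq)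
    fix x
    assume "x \<in> topspace X"
    from index_SU_embed[OF SU_D(1)[OF continuous_map_SU_carrier[OF f this]] ij]
    show "(if i < n \<and> j < n then f x $$ (i, j) else if i = j then 1 else 0) = SU_embed (f x) $$ (i, j)"
      by simp
  qed
qed (intro SU_embed_SU continuous_map_SU_carrier[OF f])

section \<open>The commutator maps\<close>

lemma index_lambda_circle:
  assumes "i < k + 1" "l < k + 1"
  shows "lambda_circle k z $$ (i, l) = (if i = l then (if i < k then z else z powi (- int k)) else 0)"
  using assms by (auto simp: lambda_circle_def mat_diag_def)

lemma sphere_base_in_nsphere: "sphere_base \<in> topspace (nsphere n)"
  unfolding sphere_base_def by (rule in_topspace_nsphere)

lemma SU_block_corner:
  assumes a: "a \<in> carrier (SU (Suc j + 1))"
    and block: "\<And>i l. \<lbrakk>i \<le> Suc j; l \<le> Suc j; \<not> (i \<le> j \<and> l \<le> j)\<rbrakk> \<Longrightarrow> a $$ (i, l) = (if i = l then \<mu> else 0)"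
  shows "cnj \<mu> * \<mu> = 1"
proof -
  have "(\<Sum>l\<le>Suc j. (norm (a $$ (l, Suc j)))\<^sup>2) = (\<Sum>l\<le>Suc j. if l = Suc j then (norm \<mu>)\<^sup>2 else 0)"
    by (rule sum.cong) (simp_all add: block)
  then have "(norm \<mu>)\<^sup>2 = 1"
    using SU_column_unit[OF a, of "Suc j"] by simp
  then show ?thesis
    by (metis complex_norm_square mult.commute of_real_1)
qed

text \<open>The inverse of \<open>a\<close> multiplies the last basis vector by
  \<open>cnj \<mu>\<close>. This scalar is moved onto \<open>a\<close>, and
  \<open>cnj \<mu> * a\<close> has corner \<open>cnj \<mu> * \<mu>\<close> = 1, so it is a block
  matrix fixing that vector. The vector it acts on is the last column of the adjoint of
  \<open>g\<close>, the conjugated last row of \<open>g\<close>.\<close>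

lemma last_column_group_commutator:
  assumes g: "g \<in> carrier (SU (Suc j + 1))" and a: "a \<in> carrier (SU (Suc j + 1))"
    and block: "\<And>i l. \<lbrakk>i \<le> Suc j; l \<le> Suc j; \<not> (i \<le> j \<and> l \<le> j)\<rbrakk> \<Longrightarrow> a $$ (i, l) = (if i = l then \<mu> else 0)"
  shows "last_column (Suc j) (group_commutator (SU (Suc j + 1)) g a) =
    real_coords (Suc j) (mat_apply (Suc j) (\<lambda>i l. g $$ (i, l))
      (mat_apply (Suc j) (block_mat j (\<lambda>i l. cnj \<mu> * a $$ (i, l))) (\<lambda>l. cnj (g $$ (Suc j, l)))))"
  unfolding last_column_def
proof (rule real_coords_cong)
  fix i
  assume i: "i \<le> Suc j"
  let ?n = "Suc j + 1"
  have lt: "{..<?n} = {..Suc j}"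
    by (simp only: Suc_eq_plus1[symmetric] lessThan_Suc_atMost)
  note gc = SU_D(1)[OF g] and ac = SU_D(1)[OF a]
  note gc' = mat_adjoint_carrier[OF gc] and ac' = mat_adjoint_carrier[OF ac]
  note gac = mult_carrier_mat[OF gc ac]
  have i': "i < ?n" and k: "Suc j < ?n"
    using i by simp_all
  have mu: "cnj \<mu> * \<mu> = 1"
    by (rule SU_block_corner[OF a]) (rule block)
  have "group_commutator (SU ?n) g a $$ (i, Suc j) =
      (\<Sum>l\<le>Suc j. (g * a * mat_adjoint g) $$ (i, l) * mat_adjoint a $$ (l, Suc j))"
    unfolding group_commutator_SU[OF g a]
      index_mult_mat_sum[OF mult_carrier_mat[OF gac gc'] ac' i' k] lt ..
  also have "\<dots> = (\<Sum>l\<le>Suc j. if l = Suc j then (g * a * mat_adjoint g) $$ (i, l) * cnj \<mu> else 0)"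
    by (rule sum.cong) (simp_all add: index_mat_adjoint[OF ac] block)
  also have "\<dots> = (g * a * mat_adjoint g) $$ (i, Suc j) * cnj \<mu>"
    by simp
  also have "g * a * mat_adjoint g = g * (a * mat_adjoint g)"
    by (rule assoc_mult_mat[OF gc ac gc'])
  also have "(g * (a * mat_adjoint g)) $$ (i, Suc j) * cnj \<mu> =
      (\<Sum>l\<le>Suc j. g $$ (i, l) * (cnj \<mu> * (a * mat_adjoint g) $$ (l, Suc j)))"
    unfolding index_mult_mat_sum[OF gc mult_carrier_mat[OF ac gc'] i' k] lt
    by (simp only: sum_distrib_right mult.assoc mult.commute[of "cnj \<mu>"])
  also have "\<dots> = (\<Sum>l\<le>Suc j. g $$ (i, l) *
      mat_apply (Suc j) (block_mat j (\<lambda>i l. cnj \<mu> * a $$ (i, l))) (\<lambda>l. cnj (g $$ (Suc j, l))) l)"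
  proof (rule sum.cong[OF refl])
    fix l
    assume l: "l \<in> {..Suc j}"
    then have l': "l < ?n"
      by simp
    have "cnj \<mu> * (a * mat_adjoint g) $$ (l, Suc j) =
        (\<Sum>l'\<le>Suc j. (cnj \<mu> * a $$ (l, l')) * mat_adjoint g $$ (l', Suc j))"
      unfolding index_mult_mat_sum[OF ac gc' l' k] lt by (simp only: sum_distrib_left mult.assoc)
    also have "\<dots> = mat_apply (Suc j) (block_mat j (\<lambda>i l. cnj \<mu> * a $$ (i, l))) (\<lambda>l. cnj (g $$ (Suc j, l))) l"
      unfolding mat_apply_def
    proof (rule sum.cong[OF refl])
      fix l'
      assume l2: "l' \<in> {..Suc j}"
      \<comment> \<open>Inside the block both sides agree by definition; outside it
        \<open>mu\<close> turns the corner into 1.\<close>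
      have "cnj \<mu> * a $$ (l, l') = block_mat j (\<lambda>i l. cnj \<mu> * a $$ (i, l)) l l'"
        using block[of l l'] l l2 mu by (auto simp: block_mat_def)
      then show "cnj \<mu> * a $$ (l, l') * mat_adjoint g $$ (l', Suc j) =
          block_mat j (\<lambda>i l. cnj \<mu> * a $$ (i, l)) l l' * cnj (g $$ (Suc j, l'))"
        using l2 by (simp add: index_mat_adjoint[OF gc])
    qed
    finally show "g $$ (i, l) * (cnj \<mu> * (a * mat_adjoint g) $$ (l, Suc j)) = g $$ (i, l) *
        mat_apply (Suc j) (block_mat j (\<lambda>i l. cnj \<mu> * a $$ (i, l))) (\<lambda>l. cnj (g $$ (Suc j, l))) l"
      by simp
  qed
  finally show "group_commutator (SU ?n) g a $$ (i, Suc j) = mat_apply (Suc j) (\<lambda>i l. g $$ (i, l))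
      (mat_apply (Suc j) (block_mat j (\<lambda>i l. cnj \<mu> * a $$ (i, l))) (\<lambda>l. cnj (g $$ (Suc j, l)))) i"
    unfolding mat_apply_def[of "Suc j" "\<lambda>i l. g $$ (i, l)"] .
qed

text \<open>Row \<open>Suc j\<close> vanishes in the first columns, so the orthonormality of the
  columns of \<open>a\<close> restricts to the block, and the scalar has norm 1.\<close>

lemma isometric_SU_block:
  assumes a: "a \<in> carrier (SU (Suc j + 1))"
    and block: "\<And>i l. \<lbrakk>i \<le> Suc j; l \<le> Suc j; \<not> (i \<le> j \<and> l \<le> j)\<rbrakk> \<Longrightarrow> a $$ (i, l) = (if i = l then \<mu> else 0)"
  shows "isometric_mat j (\<lambda>i l. cnj \<mu> * a $$ (i, l))"
proof (rule isometric_mat_orthonormal)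
  have mu: "cnj \<mu> * \<mu> = 1"
    by (rule SU_block_corner[OF a]) (rule block)
  fix l l'
  assume l: "l \<le> j" "l' \<le> j"
  have "(\<Sum>i\<le>j. (cnj \<mu> * a $$ (i, l)) * cnj (cnj \<mu> * a $$ (i, l'))) = (\<Sum>i\<le>j. a $$ (i, l) * cnj (a $$ (i, l')))"
  proof (rule sum.cong[OF refl])
    fix i
    have "(cnj \<mu> * a $$ (i, l)) * cnj (cnj \<mu> * a $$ (i, l')) = (cnj \<mu> * \<mu>) * (a $$ (i, l) * cnj (a $$ (i, l')))"
      by (simp add: mult_ac)
    then show "(cnj \<mu> * a $$ (i, l)) * cnj (cnj \<mu> * a $$ (i, l')) = a $$ (i, l) * cnj (a $$ (i, l'))"
      unfolding mu by simp
  qed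
  also have "\<dots> = (\<Sum>i<Suc j + 1. a $$ (i, l) * cnj (a $$ (i, l')))"
    using block[of "Suc j" l] l by (simp add: lessThan_Suc_atMost)
  also have "\<dots> = (if l = l' then 1 else 0)"
    using l by (intro SU_columns_orthonormal[OF a]) simp_all
  finally show "(\<Sum>i\<le>j. (cnj \<mu> * a $$ (i, l)) * cnj (cnj \<mu> * a $$ (i, l'))) = (if l = l' then 1 else 0)" .
qed

text \<open>The factor \<open>d\<close> is the degree of the map comparing \<open>q\<close> with the
  join coordinates; its existence is enough to transfer nonvanishing.\<close>

lemma commutator_map:
  fixes q :: "complex \<times> (nat \<Rightarrow> real) \<Rightarrow> nat \<Rightarrow> real"
  assumes g: "circle_contraction (Suc j) g" and q: "sphere_identification (2 * j + 1) q"
    and a: "continuous_map (nsphere (2 * j + 1)) (SU_space (Suc j + 1)) a"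
    and a1: "a sphere_base = 1\<^sub>m (Suc j + 1)"
    and block: "\<And>u i l. \<lbrakk>u \<in> topspace (nsphere (2 * j + 1)); i \<le> Suc j; l \<le> Suc j; \<not> (i \<le> j \<and> l \<le> j)\<rbrakk>
        \<Longrightarrow> a u $$ (i, l) = (if i = l then a u $$ (Suc j, Suc j) else 0)"
    and f: "\<And>x t. \<lbrakk>x \<in> cball 0 1; t \<in> topspace (nsphere (2 * j + 1))\<rbrakk>
        \<Longrightarrow> f (q (x, t)) = group_commutator (SU (Suc j + 1)) (g x) (a t)"
  shows "f \<in> based_maps (2 * j + 1 + 2) (SU_space (Suc j + 1)) (1\<^sub>m (Suc j + 1))"
    and "\<exists>d. Brouwer_degree2 (2 * j + 1 + 2) (last_column (Suc j) \<circ> f) * d = int (Suc j) *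
      Brouwer_degree2 (2 * j + 1) (\<lambda>u. real_coords j (\<lambda>i. cnj (a u $$ (Suc j, Suc j)) * a u $$ (i, j)))"
proof -
  let ?m = "2 * j + 1"
  let ?n = "Suc j + 1"
  have gc: "continuous_map (top_of_set (cball 0 1)) (SU_space ?n) g"
    and gb: "\<And>x. x \<in> sphere 0 1 \<Longrightarrow> g x = lambda_circle (Suc j) x"
    using g by (auto simp: circle_contraction_def)
  have gSU: "g z \<in> carrier (SU ?n)" if "z \<in> cball 0 1" for z
    using continuous_map_SU_carrier[OF gc] that by simp
  have aSU: "a u \<in> carrier (SU ?n)" if "u \<in> topspace (nsphere ?m)" for u
    using continuous_map_SU_carrier[OF a that] .
  have quo: "quotient_map (disc_sphere ?m) (nsphere (?m + 2)) q"
    and qcoll: "\<And>p. p \<in> collapsed_set ?m \<Longrightarrow> q p = sphere_base"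
    using q by (auto simp: sphere_identification_def)
  have base: "sphere_base \<in> topspace (nsphere ?m)"
    by (rule sphere_base_in_nsphere)

  have fc: "continuous_map (nsphere (?m + 2)) (SU_space ?n) f"
  proof (rule continuous_compose_quotient_map[OF quo])
    have "continuous_map (disc_sphere ?m) (SU_space ?n) (g \<circ> fst)"
      by (rule continuous_map_compose[OF continuous_map_fst gc])
    moreover have "continuous_map (disc_sphere ?m) (SU_space ?n) (a \<circ> snd)"
      by (rule continuous_map_compose[OF continuous_map_snd a])
    ultimately have "continuous_map (disc_sphere ?m) (SU_space ?n)
        (\<lambda>p. g (fst p) * a (snd p) * mat_adjoint (g (fst p)) * mat_adjoint (a (snd p)))"
      unfolding o_def by (intro continuous_map_SU_mult continuous_map_SU_adjoint)
    then show "continuous_map (disc_sphere ?m) (SU_space ?n) (f \<circ> q)"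
    proof (rule continuous_map_eq)
      fix p
      assume "p \<in> topspace (disc_sphere ?m)"
      then have p: "fst p \<in> cball 0 1" "snd p \<in> topspace (nsphere ?m)"
        by (simp_all add: mem_Times_iff)
      show "g (fst p) * a (snd p) * mat_adjoint (g (fst p)) * mat_adjoint (a (snd p)) = (f \<circ> q) p"
        using f[OF p] group_commutator_SU[OF gSU[OF p(1)] aSU[OF p(2)]] by simp
    qed
  qed
  moreover have "f sphere_base = 1\<^sub>m ?n"
  proof -
    have "q (1, sphere_base) = sphere_base"
      by (rule qcoll) (simp add: collapsed_set_def)
    moreover have "f (q (1, sphere_base)) = group_commutator (SU ?n) (g 1) (a sphere_base)"
      by (rule f) (simp_all add: sphere_base_in_nsphere)
    moreover have "group_commutator (SU ?n) (g 1) (a sphere_base) = g 1 * mat_adjoint (g 1)"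
      using gSU[of 1] aSU[OF base] SU_D(1)[OF gSU[of 1]] mat_adjoint_carrier[OF SU_D(1)[OF gSU[of 1]]]
      by (simp add: group_commutator_SU a1 mat_adjoint_one)
    ultimately show ?thesis
      using SU_D(2)[OF gSU[of 1]] by simp
  qed
  ultimately show "f \<in> based_maps (?m + 2) (SU_space ?n) (1\<^sub>m ?n)"
    by (simp add: based_maps_def)

  \<comment> \<open>\<open>q\<close> is constant on the whole of circle x S^m, in particular over
    each z on the circle, so it descends along \<open>join_map\<close>.\<close>
  have "continuous_map (disc_sphere ?m) (nsphere (?m + 2)) (\<lambda>(z, u). q (z, u))"
    using quotient_imp_continuous_map[OF quo] by simp
  then obtain p where p: "continuous_map (nsphere (?m + 2)) (nsphere (?m + 2)) p"
    and pj: "\<And>z u. \<lbrakk>z \<in> cball 0 1; u \<in> topspace (nsphere ?m)\<rbrakk> \<Longrightarrow> p (join_map ?m z u) = q (z, u)"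
  proof (rule join_map_descend)
    fix z :: complex and u u'
    assume "norm z = 1" "u \<in> topspace (nsphere ?m)" "u' \<in> topspace (nsphere ?m)"
    then have "(z, u) \<in> collapsed_set ?m" "(z, u') \<in> collapsed_set ?m"
      by (simp_all add: collapsed_set_def)
    then show "q (z, u) = q (z, u')"
      by (simp add: qcoll)
  qed (rule that; assumption)
  have lc: "continuous_map (nsphere (?m + 2)) (nsphere (?m + 2)) (last_column (Suc j) \<circ> f)"
    using continuous_map_compose[OF fc continuous_map_last_column[of "Suc j"]] by simp
  let ?\<mu> = "\<lambda>u. a u $$ (Suc j, Suc j)"
  have deg: "Brouwer_degree2 (?m + 2) ((last_column (Suc j) \<circ> f) \<circ> p) =
      int (Suc j) * Brouwer_degree2 ?m (\<lambda>u. real_coords j (\<lambda>i. cnj (?\<mu> u) * a u $$ (i, j)))"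
  proof (rule Brouwer_degree2_commutator_column[where g = "\<lambda>z i l. g z $$ (i, l)"
        and v = "\<lambda>z l. cnj (g z $$ (Suc j, l))" and b = "\<lambda>u i l. cnj (?\<mu> u) * a u $$ (i, l)"])
    show gc': "continuous_on (cball 0 1) (\<lambda>z. g z $$ (i, l))" if "i \<le> Suc j" "l \<le> Suc j" for i l
      using continuous_map_SU_entry[OF gc, of i l] that by simp
    show "isometric_mat (Suc j) (\<lambda>i l. g z $$ (i, l))" if "z \<in> cball 0 1" for z
      using isometric_SU gSU[OF that] by blast
    show "g 1 $$ (i, l) = (if i = l then 1 else 0)" if "i \<le> Suc j" "l \<le> Suc j" for i l
      using gb[of 1] that by (simp add: index_lambda_circle)
    show "continuous_on (cball 0 1) (\<lambda>z. cnj (g z $$ (Suc j, i)))" if "i \<le> Suc j" for i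
      using gc'[of "Suc j" i] that by (intro continuous_on_cnj) simp
    show "(\<Sum>i\<le>Suc j. (norm (cnj (g z $$ (Suc j, i))))\<^sup>2) = 1" if "z \<in> cball 0 1" for z
    proof -
      have "(\<Sum>i\<le>Suc j. (norm (mat_adjoint (g z) $$ (i, Suc j)))\<^sup>2) = 1"
        by (rule SU_column_unit[OF mat_adjoint_SU[OF gSU[OF that]]]) simp
      moreover have "(\<Sum>i\<le>Suc j. (norm (mat_adjoint (g z) $$ (i, Suc j)))\<^sup>2) =
          (\<Sum>i\<le>Suc j. (norm (cnj (g z $$ (Suc j, i))))\<^sup>2)"
        by (rule sum.cong) (simp_all add: index_mat_adjoint[OF SU_D(1)[OF gSU[OF that]]])
      ultimately show ?thesis
        by simp
    qed
    \<comment> \<open>The origin of the factor k = \<open>Suc j\<close> in the degree: the last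
      entry of \<open>lambda_circle\<close> has weight -k, and conjugating it on the circle gives
      z^k.\<close>
    show "cnj (g z $$ (Suc j, i)) = (if i = Suc j then z ^ Suc j else 0)" if "norm z = 1" "i \<le> Suc j" for z i
    proof -
      have "z * cnj z = 1"
        using that(1) by (simp add: complex_norm_square[symmetric])
      then have "inverse (cnj z) = z"
        by (metis inverse_unique mult.commute)
      then have "cnj (z powi (- int (Suc j))) = z ^ Suc j"
        by (simp only: power_int_minus power_int_of_nat complex_cnj_inverse complex_cnj_power
            power_inverse[symmetric])
      then show ?thesis
        using gb[of z] that by (simp add: index_lambda_circle del: of_nat_Suc power_Suc)
    qed
    show "continuous_map (nsphere ?m) euclidean (\<lambda>u. cnj (?\<mu> u) * a u $$ (i, l))"
      if "i \<le> j" "l \<le> j" for i l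
    proof (rule continuous_map_complex_mult)
      show "continuous_map (nsphere ?m) euclidean (\<lambda>u. cnj (?\<mu> u))"
        using continuous_map_comp_on[OF continuous_map_SU_entry[OF a, of "Suc j" "Suc j"], of UNIV cnj]
        by (simp add: continuous_intros)
      show "continuous_map (nsphere ?m) euclidean (\<lambda>u. a u $$ (i, l))"
        using that by (intro continuous_map_SU_entry[OF a]) simp_all
    qed
    show "isometric_mat j (\<lambda>i l. cnj (?\<mu> u) * a u $$ (i, l))" if "u \<in> topspace (nsphere ?m)" for u
      by (rule isometric_SU_block[OF aSU[OF that]]) (rule block[OF that])
    fix z :: complex and u
    assume zu: "z \<in> cball 0 1" "u \<in> topspace (nsphere ?m)"
    show "((last_column (Suc j) \<circ> f) \<circ> p) (join_map ?m z u) =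
        real_coords (Suc j) (mat_apply (Suc j) (\<lambda>i l. g z $$ (i, l))
          (mat_apply (Suc j) (block_mat j (\<lambda>i l. cnj (?\<mu> u) * a u $$ (i, l))) (\<lambda>l. cnj (g z $$ (Suc j, l)))))"
      unfolding o_apply pj[OF zu] f[OF zu]
      by (rule last_column_group_commutator[OF gSU[OF zu(1)] aSU[OF zu(2)]]) (rule block[OF zu(2)])
  qed
  show "\<exists>d. Brouwer_degree2 (?m + 2) (last_column (Suc j) \<circ> f) * d =
      int (Suc j) * Brouwer_degree2 ?m (\<lambda>u. real_coords j (\<lambda>i. cnj (?\<mu> u) * a u $$ (i, j)))"
    using deg unfolding Brouwer_degree2_compose[OF p lc] by (rule exI[of _ "Brouwer_degree2 (?m + 2) p"])
qed

text \<open>The invariant of the induction. One suitable representative is enough, since the degree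
  does not change under homotopy.\<close>

definition nonzero_column_degree :: "nat \<Rightarrow> ((nat \<Rightarrow> real) \<Rightarrow> complex mat) set \<Rightarrow> bool" where
  "nonzero_column_degree k c \<longleftrightarrow>
     (\<exists>f\<in>based_maps (2 * k + 1) (SU_space (k + 1)) (1\<^sub>m (k + 1)).
        c = based_homotopy_class (2 * k + 1) (SU_space (k + 1)) (1\<^sub>m (k + 1)) f \<and>
        Brouwer_degree2 (2 * k + 1) (last_column k \<circ> f) \<noteq> 0)"

text \<open>Common induction step for \<open>alpha_1\<close> (corner \<mu> = 1/z) and for embedded
  maps (corner 1). In \<open>commutator_map\<close> the right side is a product of two nonzero
  factors, so the degree on the left is nonzero.\<close>

lemma commutator_class_nonzero_column_degree:
  assumes c: "commutator_class (Suc j) a c"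
    and a: "continuous_map (nsphere (2 * j + 1)) (SU_space (Suc j + 1)) a"
    and a1: "a sphere_base = 1\<^sub>m (Suc j + 1)"
    and block: "\<And>u i l. \<lbrakk>u \<in> topspace (nsphere (2 * j + 1)); i \<le> Suc j; l \<le> Suc j; \<not> (i \<le> j \<and> l \<le> j)\<rbrakk>
        \<Longrightarrow> a u $$ (i, l) = (if i = l then a u $$ (Suc j, Suc j) else 0)"
    and deg: "Brouwer_degree2 (2 * j + 1) (\<lambda>u. real_coords j (\<lambda>i. cnj (a u $$ (Suc j, Suc j)) * a u $$ (i, j))) \<noteq> 0"
  shows "nonzero_column_degree (Suc j) c"
proof -
  have e: "2 * Suc j - 1 = 2 * j + 1" "2 * Suc j + 1 = 2 * j + 1 + 2"
    by simp_all
  obtain g q f where g: "circle_contraction (Suc j) g" and q: "sphere_identification (2 * j + 1) q"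
    and f: "\<And>x t. \<lbrakk>x \<in> cball 0 1; t \<in> topspace (nsphere (2 * j + 1))\<rbrakk>
      \<Longrightarrow> f (q (x, t)) = group_commutator (SU (Suc j + 1)) (g x) (a t)"
    and cf: "c = based_homotopy_class (2 * j + 1 + 2) (SU_space (Suc j + 1)) (1\<^sub>m (Suc j + 1)) f"
    using c unfolding commutator_class_def one_SU e by blast
  note cm = commutator_map[OF g q a a1 block f]
  have "Brouwer_degree2 (2 * j + 1 + 2) (last_column (Suc j) \<circ> f) \<noteq> 0"
    using cm(2) deg by auto
  then show ?thesis
    unfolding nonzero_column_degree_def e using cm(1) cf by blast
qed

text \<open>For j = 0 the block is the single entry z and the corner is its inverse, so on the
  circle \<open>cnj \<mu> * z\<close> is z^2.\<close>

lemma commutator_class_alpha_1: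
  assumes "commutator_class 1 alpha_1 c"
  shows "nonzero_column_degree 1 c"
proof -
  let ?z = "\<lambda>t::nat \<Rightarrow> real. Complex (t 0) (t 1)"
  have z: "norm (?z t) = 1" if "t \<in> topspace (nsphere 1)" for t
    using nsphere_1_circle[OF that] by simp
  have ent: "alpha_1 t $$ (i, l) = (if i = l then (if i < 1 then ?z t else inverse (?z t)) else 0)"
    if "i < 2" "l < 2" for t i l
    using that index_lambda_circle[of i 1 l "?z t"] by (simp add: alpha_1_def power_int_minus)
  have "nonzero_column_degree (Suc 0) c"
  proof (rule commutator_class_nonzero_column_degree[of 0 alpha_1])
    show "commutator_class (Suc 0) alpha_1 c"
      using assms by simp
    show "continuous_map (nsphere (2 * 0 + 1)) (SU_space (Suc 0 + 1)) alpha_1"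
    proof (rule continuous_map_into_SU)
      fix i l :: nat
      assume il: "i < Suc 0 + 1" "l < Suc 0 + 1"
      have "continuous_map (nsphere 1) euclidean ?z"
        by (rule continuous_map_nsphere_circle)
      moreover from this have "continuous_map (nsphere 1) euclidean (\<lambda>t. inverse (?z t))"
        by (rule continuous_map_comp_on[where S = "sphere 0 1"])
          (use z in \<open>auto intro!: continuous_intros\<close>)
      ultimately show "continuous_map (nsphere (2 * 0 + 1)) euclidean (\<lambda>t. alpha_1 t $$ (i, l))"
        using ent il by simp
    next
      fix t
      assume "t \<in> topspace (nsphere (2 * 0 + 1))"
      then have "?z t \<in> sphere 0 1"
        using z by simp
      then show "alpha_1 t \<in> carrier (SU (Suc 0 + 1))"
        unfolding alpha_1_def using lambda_circle_in_SU[of "?z t" 1] by simp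
    qed
    have "lambda_circle 1 1 = 1\<^sub>m 2"
      by (rule eq_matI) (simp_all add: lambda_circle_def mat_diag_def)
    moreover have "?z sphere_base = 1"
      by (simp add: sphere_base_def complex_eq_iff)
    ultimately show "alpha_1 sphere_base = 1\<^sub>m (Suc 0 + 1)"
      unfolding alpha_1_def by (simp add: numeral_2_eq_2)
    show "alpha_1 u $$ (i, l) = (if i = l then alpha_1 u $$ (Suc 0, Suc 0) else 0)"
      if "i \<le> Suc 0" "l \<le> Suc 0" "\<not> (i \<le> 0 \<and> l \<le> 0)" for u i l
      using that ent by (auto simp: le_Suc_eq)
    have "Brouwer_degree2 (2 * 0 + 1)
        (\<lambda>u. real_coords 0 (\<lambda>i. cnj (alpha_1 u $$ (Suc 0, Suc 0)) * alpha_1 u $$ (i, 0))) =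
      Brouwer_degree2 1 (circle_map (\<lambda>z. z ^ 2))"
    proof (simp only: mult_0_right add_0, rule Brouwer_degree2_eq)
      fix u
      assume u: "u \<in> topspace (nsphere 1)"
      have "?z u * cnj (?z u) = 1"
        using z[OF u] by (simp add: complex_norm_square[symmetric])
      then have "cnj (inverse (?z u)) = ?z u"
        by (metis inverse_unique complex_cnj_cnj)
      then have e: "cnj (alpha_1 u $$ (Suc 0, Suc 0)) * alpha_1 u $$ (0, 0) = (?z u) ^ 2"
        using ent[of 1 1 u] ent[of 0 0 u] by (simp add: power2_eq_square)
      show "real_coords 0 (\<lambda>i. cnj (alpha_1 u $$ (Suc 0, Suc 0)) * alpha_1 u $$ (i, 0)) =
          circle_map (\<lambda>z. z ^ 2) u"
      proof
        fix i
        show "real_coords 0 (\<lambda>i. cnj (alpha_1 u $$ (Suc 0, Suc 0)) * alpha_1 u $$ (i, 0)) i =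
            circle_map (\<lambda>z. z ^ 2) u i"
          unfolding real_coords_def circle_map_def e[symmetric] by (auto simp: le_Suc_eq)
      qed
    qed
    then show "Brouwer_degree2 (2 * 0 + 1)
        (\<lambda>u. real_coords 0 (\<lambda>i. cnj (alpha_1 u $$ (Suc 0, Suc 0)) * alpha_1 u $$ (i, 0))) \<noteq> 0"
      using Brouwer_degree2_circle_power[of 2] by simp
  qed
  then show ?thesis
    by simp
qed

lemma commutator_class_SU_embed:
  assumes nz: "nonzero_column_degree j c'" and ac: "a \<in> c'"
    and c: "commutator_class (Suc j) (SU_embed \<circ> a) c"
  shows "nonzero_column_degree (Suc j) c"
proof -
  obtain f where c': "c' = based_homotopy_class (2 * j + 1) (SU_space (j + 1)) (1\<^sub>m (j + 1)) f"
    and deg: "Brouwer_degree2 (2 * j + 1) (last_column j \<circ> f) \<noteq> 0"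
    using nz by (auto simp: nonzero_column_degree_def)
  \<comment> \<open>\<open>a\<close> is an arbitrary member of the class, known only to be homotopic
    to \<open>f\<close>; composing with \<open>last_column\<close> carries the nonzero degree over
    to it.\<close>
  have hom: "homotopic_with (\<lambda>h. h sphere_base = 1\<^sub>m (j + 1)) (nsphere (2 * j + 1)) (SU_space (j + 1)) f a"
    using ac unfolding c' based_homotopy_class_def by simp
  have a: "continuous_map (nsphere (2 * j + 1)) (SU_space (j + 1)) a" and a1: "a sphere_base = 1\<^sub>m (j + 1)"
    using homotopic_with_imp_continuous_maps[OF hom] homotopic_with_imp_property[OF hom] by blast+
  have "homotopic_with (\<lambda>_. True) (nsphere (2 * j + 1)) (nsphere (2 * j + 1)) (last_column j \<circ> f) (last_column j \<circ> a)"
    by (rule homotopic_with_compose_continuous_map_left[OF hom continuous_map_last_column]) simp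
  then have deg_a: "Brouwer_degree2 (2 * j + 1) (last_column j \<circ> a) \<noteq> 0"
    using Brouwer_degree2_homotopic deg by metis
  have ent: "SU_embed (a u) $$ (i, l) = (if i < j + 1 \<and> l < j + 1 then a u $$ (i, l) else if i = l then 1 else 0)"
    if "u \<in> topspace (nsphere (2 * j + 1))" "i \<le> Suc j" "l \<le> Suc j" for u i l
    using that by (intro index_SU_embed SU_D(1) continuous_map_SU_carrier[OF a]) simp_all
  show ?thesis
  proof (rule commutator_class_nonzero_column_degree[OF c])
    show "continuous_map (nsphere (2 * j + 1)) (SU_space (Suc j + 1)) (SU_embed \<circ> a)"
      using continuous_map_SU_embed[OF a] by (simp add: o_def)
    show "(SU_embed \<circ> a) sphere_base = 1\<^sub>m (Suc j + 1)"
      using SU_embed_one[of "j + 1"] a1 by simp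
    show "(SU_embed \<circ> a) u $$ (i, l) = (if i = l then (SU_embed \<circ> a) u $$ (Suc j, Suc j) else 0)"
      if "u \<in> topspace (nsphere (2 * j + 1))" "i \<le> Suc j" "l \<le> Suc j" "\<not> (i \<le> j \<and> l \<le> j)" for u i l
      using ent[OF that(1-3)] ent[OF that(1), of "Suc j" "Suc j"] that(4) by auto
    have "Brouwer_degree2 (2 * j + 1) (\<lambda>u. real_coords j (\<lambda>i. cnj ((SU_embed \<circ> a) u $$ (Suc j, Suc j)) *
        (SU_embed \<circ> a) u $$ (i, j))) = Brouwer_degree2 (2 * j + 1) (last_column j \<circ> a)"
    proof (rule Brouwer_degree2_eq)
      fix u
      assume u: "u \<in> topspace (nsphere (2 * j + 1))"
      show "real_coords j (\<lambda>i. cnj ((SU_embed \<circ> a) u $$ (Suc j, Suc j)) * (SU_embed \<circ> a) u $$ (i, j)) =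
          (last_column j \<circ> a) u"
        unfolding o_apply last_column_def by (rule real_coords_cong) (simp add: ent[OF u])
    qed
    then show "Brouwer_degree2 (2 * j + 1) (\<lambda>u. real_coords j (\<lambda>i. cnj ((SU_embed \<circ> a) u $$ (Suc j, Suc j)) *
        (SU_embed \<circ> a) u $$ (i, j))) \<noteq> 0"
      using deg_a by simp
  qed
qed

text \<open>A null homotopy in SU(k+1) would give, after \<open>last_column\<close>, one on the
  sphere, and constant maps have degree 0.\<close>

lemma nonzero_column_degree_nonzero:
  assumes "nonzero_column_degree k c"
  shows "c \<in> homotopy_group_set (2 * k + 1) (SU_space (k + 1)) (1\<^sub>m (k + 1))"
    and "c \<noteq> homotopy_group_zero (2 * k + 1) (SU_space (k + 1)) (1\<^sub>m (k + 1))"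
proof -
  obtain f where f: "f \<in> based_maps (2 * k + 1) (SU_space (k + 1)) (1\<^sub>m (k + 1))"
    and c: "c = based_homotopy_class (2 * k + 1) (SU_space (k + 1)) (1\<^sub>m (k + 1)) f"
    and deg: "Brouwer_degree2 (2 * k + 1) (last_column k \<circ> f) \<noteq> 0"
    using assms by (auto simp: nonzero_column_degree_def)
  show "c \<in> homotopy_group_set (2 * k + 1) (SU_space (k + 1)) (1\<^sub>m (k + 1))"
    unfolding homotopy_group_set_def c using f by (rule imageI)
  show "c \<noteq> homotopy_group_zero (2 * k + 1) (SU_space (k + 1)) (1\<^sub>m (k + 1))"
  proof
    assume "c = homotopy_group_zero (2 * k + 1) (SU_space (k + 1)) (1\<^sub>m (k + 1))"
    \<comment> \<open>Reflexivity: if \<open>c\<close> were the zero class, membership of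
      \<open>f\<close> in it would be a homotopy from the constant map to \<open>f\<close>.\<close>
    moreover have "f \<in> c"
      unfolding c based_homotopy_class_def using f by (simp add: based_maps_def)
    ultimately have "homotopic_with (\<lambda>h. h sphere_base = 1\<^sub>m (k + 1)) (nsphere (2 * k + 1)) (SU_space (k + 1))
        (\<lambda>_. 1\<^sub>m (k + 1)) f"
      by (simp add: homotopy_group_zero_def based_homotopy_class_def)
    then have "homotopic_with (\<lambda>_. True) (nsphere (2 * k + 1)) (nsphere (2 * k + 1))
        (last_column k \<circ> (\<lambda>_. 1\<^sub>m (k + 1))) (last_column k \<circ> f)"
      by (rule homotopic_with_compose_continuous_map_left[OF _ continuous_map_last_column]) simp
    then have "Brouwer_degree2 (2 * k + 1) (last_column k \<circ> f) = Brouwer_degree2 (2 * k + 1) (\<lambda>_. last_column k (1\<^sub>m (k + 1)))"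
      using Brouwer_degree2_homotopic by (fastforce simp: o_def)
    then show False
      using deg Brouwer_degree2_const by simp
  qed
qed

text \<open>Each stage supplies some representative \<open>a\<close> of the preceding class, not a
  prescribed one; this is why the invariant of the induction is attached to classes rather than to
  maps.\<close>

theorem lemma2p5:
  fixes n :: nat and \<alpha> :: "nat \<Rightarrow> ((nat \<Rightarrow> real) \<Rightarrow> complex mat) set"
  assumes "n \<ge> 1"
    and "commutator_class 1 alpha_1 (\<alpha> 3)"
    and "\<And>k. 2 \<le> k \<Longrightarrow> k \<le> n \<Longrightarrow>
           \<exists>a\<in>\<alpha> (2 * k - 1). commutator_class k (SU_embed \<circ> a) (\<alpha> (2 * k + 1))"
  shows "\<forall>k\<in>{1..n}.
           \<alpha> (2 * k + 1) \<in> homotopy_group_set (2 * k + 1) (SU_space (k + 1)) \<one>\<^bsub>SU (k + 1)\<^esub> \<and>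
           \<alpha> (2 * k + 1) \<noteq> homotopy_group_zero (2 * k + 1) (SU_space (k + 1)) \<one>\<^bsub>SU (k + 1)\<^esub>"
proof
  fix k
  assume "k \<in> {1..n}"
  then have "1 \<le> k" "k \<le> n"
    by simp_all
  then have "nonzero_column_degree k (\<alpha> (2 * k + 1))"
  proof (induction k rule: dec_induct)
    case base
    have "2 * 1 + 1 = (3::nat)"
      by simp
    then show ?case
      using commutator_class_alpha_1[OF assms(2)] by metis
  next
    case (step j)
    have "2 * Suc j - 1 = 2 * j + 1"
      by simp
    then obtain a where "a \<in> \<alpha> (2 * j + 1)" "commutator_class (Suc j) (SU_embed \<circ> a) (\<alpha> (2 * Suc j + 1))"
      using assms(3)[of "Suc j"] step by auto
    then show ?case
      using commutator_class_SU_embed step by simp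
  qed
  then show "\<alpha> (2 * k + 1) \<in> homotopy_group_set (2 * k + 1) (SU_space (k + 1)) \<one>\<^bsub>SU (k + 1)\<^esub> \<and>
      \<alpha> (2 * k + 1) \<noteq> homotopy_group_zero (2 * k + 1) (SU_space (k + 1)) \<one>\<^bsub>SU (k + 1)\<^esub>"
    using nonzero_column_degree_nonzero by simp
qed

end
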